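(* For every integer $k\geq 2$ there exists a finite double-magical graph $G$ with $\omega(G)=k$ and $\chi(G)=\frac{k+1}{2}\binom{k+2}{3}$.
   Context: A double-ordered graph $H_{<,<'}$ (graph with two total orders on its vertex set) is magical if for any three distinct vertices $a< b< c$ with $ab,bc\in E(H)$ and $ac\notin E(H)$ we have $b<' a$ and $b<' c$. A triple-ordered graph $G_{<_1,<_2,<_3}$ (graph with three total orders on its vertex set) is double-magical if there exist graphs $G^1,G^2$ on $V(G)$ such that $G^1_{<_1,<_2}$ and $G^2_{<_1,<_3}$ are magical and $E(G)=E(G^1)\cap E(G^2)$. A graph $G$ is double-magical if there exist total orders $<_1,<_2,<_3$ on $V(G)$ such that $G_{<_1,<_2,<_3}$ is double-magical. $\omega$ and $\chi$ denote clique number and chromatic number. *)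

theory Defs
  imports Complex_Main "HOL-Library.Ramsey"
begin

text \<open>
  A graph is given by its vertex set \<open>V\<close> and its edge set \<open>E\<close>, whose members are
  two-element subsets of \<open>V\<close>.  Total orders are given by their strict parts.
\<close>

definition is_graph :: "'a set \<Rightarrow> 'a set set \<Rightarrow> bool" where
  "is_graph V E \<longleftrightarrow> E \<subseteq> nsets V 2"

definition total_order :: "'a set \<Rightarrow> 'a rel \<Rightarrow> bool" where
  "total_order V r \<longleftrightarrow> r \<subseteq> V \<times> V \<and> strict_linear_order_on V r"

definition magical :: "'a set \<Rightarrow> 'a set set \<Rightarrow> 'a rel \<Rightarrow> 'a rel \<Rightarrow> bool" where
  "magical V E r s \<longleftrightarrow>
     is_graph V E \<and> total_order V r \<and> total_order V s \<and>
     (\<forall>a\<in>V. \<forall>b\<in>V. \<forall>c\<in>V.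
        (a, b) \<in> r \<and> (b, c) \<in> r \<and> {a, b} \<in> E \<and> {b, c} \<in> E \<and> {a, c} \<notin> E
        \<longrightarrow> (b, a) \<in> s \<and> (b, c) \<in> s)"

definition double_magical_wrt ::
    "'a set \<Rightarrow> 'a set set \<Rightarrow> 'a rel \<Rightarrow> 'a rel \<Rightarrow> 'a rel \<Rightarrow> bool" where
  "double_magical_wrt V E r1 r2 r3 \<longleftrightarrow>
     is_graph V E \<and> total_order V r1 \<and> total_order V r2 \<and> total_order V r3 \<and>
     (\<exists>E1 E2. magical V E1 r1 r2 \<and> magical V E2 r1 r3 \<and> E = E1 \<inter> E2)"

definition double_magical :: "'a set \<Rightarrow> 'a set set \<Rightarrow> bool" where
  "double_magical V E \<longleftrightarrow> (\<exists>r1 r2 r3. double_magical_wrt V E r1 r2 r3)"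

text \<open>
  The clique number and the chromatic number are only meaningful for finite \<open>V\<close>.
\<close>

definition clique_number :: "'a set \<Rightarrow> 'a set set \<Rightarrow> nat" where
  "clique_number V E = Max {card K | K. K \<subseteq> V \<and> clique K E}"

definition proper_colouring :: "'a set \<Rightarrow> 'a set set \<Rightarrow> nat \<Rightarrow> ('a \<Rightarrow> nat) \<Rightarrow> bool" where
  "proper_colouring V E n f \<longleftrightarrow>
     f ` V \<subseteq> {..<n} \<and> (\<forall>u\<in>V. \<forall>v\<in>V. {u, v} \<in> E \<longrightarrow> f u \<noteq> f v)"

definition chromatic_number :: "'a set \<Rightarrow> 'a set set \<Rightarrow> nat" where
  "chromatic_number V E = (LEAST n. \<exists>f. proper_colouring V E n f)"

end

theory Submission
  imports Defs "HOL-Library.Countable" "HOL-Library.FuncSet"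
begin

text \<open>
  Orient every edge along \<open><\<^sub>1\<close>. An edge of a magical graph goes up or down in the second order, and
  being magical says that an up edge followed by an edge, and an edge followed by a down edge, can
  be short-cut. So a double-magical graph has four kinds of edges, given by their directions in
  \<open><\<^sub>2\<close> and \<open><\<^sub>3\<close>, each of which is a partial order.

  Using only edges with opposite directions in \<open><\<^sub>2\<close> and \<open><\<^sub>3\<close>, one forces \<open>k\<^sup>2\<close> colours:
  to each vertex belong bounds \<open>(b, c)\<close>, each less than \<open>k\<close>, for its cliques of either kind, and
  a new leftmost vertex of rank \<open>(b, c)\<close> can see all vertices of ranks \<open>(b', c')\<close> with \<open>b' < b\<close> or
  \<open>c' < c\<close>. Adding one such vertex for every possible choice of neighbours in many copies
  of the graph built so far, the ranks are realised one after another, in lexicographic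
  order, by vertices with different colours.

  Joining a graph with clique number \<open>k - 1\<close> by edges that go down twice to transversals of copies of
  this graph adds its colours to the \<open>k\<^sup>2\<close> ones while increasing the clique number only to \<open>k\<close>. This
  gives \<open>1\<^sup>2 + \<dots> + k\<^sup>2\<close> colours without edges that go up twice. The mirror image
  of a magical graph is magical, with up and down exchanged, so these graphs can be
  joined once more, which gives the sum of these sums.
\<close>

section \<open>Oriented magical graphs\<close>

text \<open>The orders are given by positions that need only separate adjacent vertices; ties can be broken
  arbitrarily afterwards.\<close>

definition oriented_magical :: "'a set \<Rightarrow> ('a \<Rightarrow> int) \<Rightarrow> ('a \<Rightarrow> int) \<Rightarrow> 'a rel \<Rightarrow> bool" where
  "oriented_magical V p q E \<longleftrightarrow> E \<subseteq> V \<times> V \<and>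
     (\<forall>x y. (x, y) \<in> E \<longrightarrow> p x < p y \<and> q x \<noteq> q y) \<and>
     (\<forall>x y z. (x, y) \<in> E \<longrightarrow> (y, z) \<in> E \<longrightarrow> q x < q y \<or> q z < q y \<longrightarrow> (x, z) \<in> E)"

definition bimagical ::
  "'a set \<Rightarrow> ('a \<Rightarrow> int) \<Rightarrow> ('a \<Rightarrow> int) \<Rightarrow> ('a \<Rightarrow> int) \<Rightarrow> 'a rel \<Rightarrow> 'a rel \<Rightarrow> bool" where
  "bimagical V p q r E1 E2 \<longleftrightarrow>
     finite V \<and> oriented_magical V p q E1 \<and> oriented_magical V p r E2"

definition no_up :: "('a \<Rightarrow> int) \<Rightarrow> ('a \<Rightarrow> int) \<Rightarrow> 'a rel \<Rightarrow> bool" where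
  "no_up q r E \<longleftrightarrow> (\<forall>x y. (x, y) \<in> E \<longrightarrow> \<not> (q x < q y \<and> r x < r y))"

definition no_down :: "('a \<Rightarrow> int) \<Rightarrow> ('a \<Rightarrow> int) \<Rightarrow> 'a rel \<Rightarrow> bool" where
  "no_down q r E \<longleftrightarrow> (\<forall>x y. (x, y) \<in> E \<longrightarrow> \<not> (q y < q x \<and> r y < r x))"

definition dclique :: "'a set \<Rightarrow> 'a rel \<Rightarrow> bool" where
  "dclique X E \<longleftrightarrow> (\<forall>x\<in>X. \<forall>y\<in>X. x \<noteq> y \<longrightarrow> (x, y) \<in> E \<or> (y, x) \<in> E)"

definition clique_le :: "'a set \<Rightarrow> 'a rel \<Rightarrow> nat \<Rightarrow> bool" where
  "clique_le V E k \<longleftrightarrow> (\<forall>X. X \<subseteq> V \<longrightarrow> dclique X E \<longrightarrow> card X \<le> k)"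

definition proper :: "'a rel \<Rightarrow> ('a \<Rightarrow> nat) \<Rightarrow> bool" where
  "proper E f \<longleftrightarrow> (\<forall>x y. (x, y) \<in> E \<longrightarrow> f x \<noteq> f y)"

text \<open>The palette size \<open>n\<close> is fixed in advance, since some constructions below have to
  be large compared with the number of available colours.\<close>

definition forces :: "nat \<Rightarrow> 'a set \<Rightarrow> 'a rel \<Rightarrow> nat \<Rightarrow> bool" where
  "forces n V E N \<longleftrightarrow> (\<forall>f. f ` V \<subseteq> {..<n} \<longrightarrow> proper E f \<longrightarrow> N \<le> card (f ` V))"

definition colourable :: "'a set \<Rightarrow> 'a rel \<Rightarrow> nat \<Rightarrow> bool" where
  "colourable V E N \<longleftrightarrow> (\<exists>f. f ` V \<subseteq> {..<N} \<and> proper E f)"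

text \<open>In an oriented magical graph this is the smallest set containing \<open>x\<close> and
  closed under following edges that go down in \<open>q\<close>. It is what a new vertex placed
  above \<open>x\<close> and joined to \<open>x\<close> must also be joined to.\<close>

definition down :: "'a rel \<Rightarrow> ('a \<Rightarrow> int) \<Rightarrow> 'a \<Rightarrow> 'a set" where
  "down E q x = insert x {y. (x, y) \<in> E \<and> q y < q x}"

lemma oriented_magicalD:
  assumes "oriented_magical V p q E"
  shows "E \<subseteq> V \<times> V" "\<And>x y. (x, y) \<in> E \<Longrightarrow> p x < p y \<and> q x \<noteq> q y"
    "\<And>x y z. (x, y) \<in> E \<Longrightarrow> (y, z) \<in> E \<Longrightarrow> q x < q y \<or> q z < q y \<Longrightarrow> (x, z) \<in> E"
  using assms unfolding oriented_magical_def by blast+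

text \<open>Two consecutive down edges starting in \<open>s\<close> are short-cut, because their
  middle vertex lies above its successor.\<close>

lemma down_closed:
  assumes "oriented_magical V p q E" "x \<in> down E q s" "(x, y) \<in> E" "q y < q x"
  shows "y \<in> down E q s"
proof (cases "x = s")
  case True
  then show ?thesis using assms(3,4) by (simp add: down_def)
next
  case False
  then have "(s, x) \<in> E" "q x < q s" using assms(2) by (auto simp: down_def)
  moreover from this have "(s, y) \<in> E"
    using oriented_magicalD(3)[OF assms(1), of s x y] assms(3,4) by blast
  ultimately show ?thesis using assms(4) by (simp add: down_def)
qed

lemma down_subset:
  assumes "oriented_magical V p q E" "x \<in> V"
  shows "down E q x \<subseteq> V"
  using oriented_magicalD(1)[OF assms(1)] assms(2) unfolding down_def by auto

text \<open>The short-cut condition is symmetric in the two outer vertices of a path, so it survives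
  the reversal of all edges, while up edges and down edges change places.\<close>

lemma oriented_magical_mirror:
  assumes "oriented_magical V p q E"
  shows "oriented_magical V (\<lambda>x. - p x) q (E\<inverse>)"
proof -
  note E = oriented_magicalD[OF assms]
  show ?thesis
    unfolding oriented_magical_def
  proof (intro conjI allI impI)
    show "E\<inverse> \<subseteq> V \<times> V" using E(1) by blast
  next
    fix x y assume "(x, y) \<in> E\<inverse>"
    then show "- p x < - p y" "q x \<noteq> q y" using E(2)[of y x] by auto
  next
    fix x y z assume "(x, y) \<in> E\<inverse>" "(y, z) \<in> E\<inverse>" "q x < q y \<or> q z < q y"
    then show "(x, z) \<in> E\<inverse>" using E(3)[of z y x] by auto
  qed
qed

lemma dclique_mirror [simp]: "dclique X (E\<inverse>) = dclique X E"
  by (simp add: dclique_def disj_commute)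

lemma clique_le_mirror [simp]: "clique_le V (E\<inverse>) k = clique_le V E k"
  unfolding clique_le_def by simp

lemma proper_mirror [simp]: "proper (E\<inverse>) f = proper E f"
  unfolding proper_def converse_iff by metis

lemma forces_mirror [simp]: "forces n V (E\<inverse>) N = forces n V E N"
  unfolding forces_def by simp

lemma colourable_mirror [simp]: "colourable V (E\<inverse>) N = colourable V E N"
  unfolding colourable_def by simp

lemma no_down_mirror: "no_up q r E \<Longrightarrow> no_down q r (E\<inverse>)"
  unfolding no_up_def no_down_def converse_iff by blast

lemma bimagical_mirror:
  "bimagical V p q r E1 E2 \<Longrightarrow> bimagical V (\<lambda>x. - p x) q r (E1\<inverse>) (E2\<inverse>)"
  unfolding bimagical_def by (simp add: oriented_magical_mirror)

section \<open>Extending copies of a graph to the left\<close>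

text \<open>A single type closed under the extensions, so that the inductions stay inside it.
  \<open>Point\<close> is the vertex of the one-vertex graphs added in \<open>ranked_step\<close>;
  countability gives the final passage to natural numbers.\<close>

datatype vertex = Point | Copy nat vertex | Top nat vertex

instance vertex :: countable
  by countable_datatype

definition ext_verts :: "nat \<Rightarrow> nat \<Rightarrow> vertex set \<Rightarrow> vertex set \<Rightarrow> vertex set" where
  "ext_verts m M V W = {Copy i x | i x. i < m \<and> x \<in> V} \<union> {Top s g | s g. s < M \<and> g \<in> W}"

text \<open>All vertices of new block \<open>s\<close> share the neighbourhood \<open>U s\<close> in
  the copies. Hence an edge inside a block followed by an edge to a copy always has its
  short-cut.\<close>

definition ext ::
  "nat \<Rightarrow> nat \<Rightarrow> vertex set \<Rightarrow> (nat \<Rightarrow> (nat \<times> vertex) set) \<Rightarrow> vertex rel \<Rightarrow> vertex rel \<Rightarrow> vertex rel"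
where
  "ext m M W U E F =
     {(Copy i x, Copy i y) | i x y. i < m \<and> (x, y) \<in> E} \<union>
     {(Top s g, Top s h) | s g h. s < M \<and> (g, h) \<in> F} \<union>
     {(Top s g, Copy i x) | s g i x. s < M \<and> g \<in> W \<and> (i, x) \<in> U s}"

lemma ext_verts_simps [simp]:
  "Copy i x \<in> ext_verts m M V W \<longleftrightarrow> i < m \<and> x \<in> V"
  "Top s g \<in> ext_verts m M V W \<longleftrightarrow> s < M \<and> g \<in> W"
  "Point \<notin> ext_verts m M V W"
  unfolding ext_verts_def by auto

lemma ext_simps [simp]:
  "(Copy i x, Copy j y) \<in> ext m M W U E F \<longleftrightarrow> i = j \<and> i < m \<and> (x, y) \<in> E"
  "(Top s g, Top t h) \<in> ext m M W U E F \<longleftrightarrow> s = t \<and> s < M \<and> (g, h) \<in> F"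
  "(Top s g, Copy i x) \<in> ext m M W U E F \<longleftrightarrow> s < M \<and> g \<in> W \<and> (i, x) \<in> U s"
  "(Copy i x, Top s g) \<notin> ext m M W U E F"
  "(Point, a) \<notin> ext m M W U E F"
  "(a, Point) \<notin> ext m M W U E F"
  unfolding ext_def by auto

lemma finite_ext_verts:
  assumes "finite V" "finite W"
  shows "finite (ext_verts m M V W)"
proof -
  have "ext_verts m M V W =
      (\<lambda>(i, x). Copy i x) ` ({..<m} \<times> V) \<union> (\<lambda>(i, x). Top i x) ` ({..<M} \<times> W)"
    unfolding ext_verts_def by (auto simp: image_def)
  then show ?thesis using assms by simp
qed

text \<open>Both magical graphs are extended over the same copies and blocks, so their intersection
  is an extension of the same kind and can be analysed directly.\<close>

lemma ext_Int:
  "ext m M W U E F \<inter> ext m M W U' E' F' = ext m M W (\<lambda>s. U s \<inter> U' s) (E \<inter> E') (F \<inter> F')"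
  unfolding ext_def by blast

section \<open>Positions and magicality of the extension\<close>

text \<open>Copy \<open>s\<close> of the new graph \<open>W\<close> is inserted as a block just below height \<open>\<theta> s\<close> of the copies
  of the old graph, of which copy \<open>i\<close> is shifted by \<open>h i\<close>.\<close>

definition placement ::
  "vertex set \<Rightarrow> (nat \<Rightarrow> int) \<Rightarrow> (nat \<Rightarrow> int) \<Rightarrow>
   (vertex \<Rightarrow> int) \<Rightarrow> (vertex \<Rightarrow> int) \<Rightarrow> (vertex \<Rightarrow> int) \<Rightarrow> bool" where
  "placement W h \<theta> q qW q' \<longleftrightarrow>
     (\<forall>i x y. q' (Copy i x) < q' (Copy i y) \<longleftrightarrow> q x < q y) \<and>
     (\<forall>s x y. q' (Top s x) < q' (Top s y) \<longleftrightarrow> qW x < qW y) \<and>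
     (\<forall>s g i x. g \<in> W \<longrightarrow> (q' (Copy i x) < q' (Top s g) \<longleftrightarrow> h i + q x < \<theta> s)) \<and>
     (\<forall>s g i x. g \<in> W \<longrightarrow> (q' (Top s g) < q' (Copy i x) \<longleftrightarrow> \<theta> s \<le> h i + q x))"

lemma placementD:
  assumes "placement W h \<theta> q qW q'"
  shows "q' (Copy i x) < q' (Copy i y) \<longleftrightarrow> q x < q y"
    "q' (Top s x) < q' (Top s y) \<longleftrightarrow> qW x < qW y"
    "g \<in> W \<Longrightarrow> q' (Copy i x) < q' (Top s g) \<longleftrightarrow> h i + q x < \<theta> s"
    "g \<in> W \<Longrightarrow> q' (Top s g) < q' (Copy i x) \<longleftrightarrow> \<theta> s \<le> h i + q x"
  using assms unfolding placement_def by blast+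

lemma finite_int_bound:
  assumes "finite A"
  obtains L :: int where "L > 0" "\<And>x. x \<in> A \<Longrightarrow> \<bar>f x\<bar> < L"
proof -
  have "\<exists>L. L > 0 \<and> (\<forall>x\<in>A. \<bar>f x\<bar> < L)"
    using assms
  proof (induction A)
    case empty
    show ?case by (intro exI[of _ 1]) auto
  next
    case (insert a A)
    then obtain L where "L > 0" "\<forall>x\<in>A. \<bar>f x\<bar> < L" by blast
    then show ?case by (intro exI[of _ "L + \<bar>f a\<bar>"]) (auto intro: add_strict_increasing)
  qed
  then show ?thesis using that by blast
qed

lemma ex_placement:
  assumes "finite W"
  obtains q' where "placement W h \<theta> q qW q'"
proof -
  obtain L :: int where L: "L > 0" "\<And>x. x \<in> W \<Longrightarrow> \<bar>qW x\<bar> < L"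
    using finite_int_bound[OF assms] by blast
  \<comment> \<open>Since \<open>L\<close> exceeds all positions within a block, old vertices sit at
    odd multiples of \<open>L\<close>, and block \<open>s\<close> stays strictly within distance
    \<open>L\<close> of the even multiple \<open>L * (2 * \<theta> s)\<close>.\<close>
  define q' where "q' v = (case v of Point \<Rightarrow> 0 | Copy i x \<Rightarrow> L * (2 * (h i + q x) + 1)
    | Top s g \<Rightarrow> L * (2 * \<theta> s) + qW g)" for v
  have lo: "L * (2 * a + 1) < L * (2 * b) + qW g" if "a < b" "g \<in> W" for a b g
  proof -
    have "2 * a + 1 \<le> 2 * b - 1" using that by simp
    then have "L * (2 * a + 1) \<le> L * (2 * b - 1)" using L(1) by (intro mult_left_mono) auto
    then show ?thesis using L(2)[OF that(2)] by (simp add: algebra_simps abs_less_iff)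
  qed
  have hi: "L * (2 * b) + qW g < L * (2 * a + 1)" if "b \<le> a" "g \<in> W" for a b g
  proof -
    have "L * (2 * b) \<le> L * (2 * a)" using that L(1) by (intro mult_left_mono) auto
    moreover have "L * (2 * a + 1) = L * (2 * a) + L" by (simp add: distrib_left)
    ultimately show ?thesis using L(2)[OF that(2)] by linarith
  qed
  have "placement W h \<theta> q qW q'"
    unfolding placement_def
  proof (intro conjI allI impI)
    fix i x y
    show "q' (Copy i x) < q' (Copy i y) \<longleftrightarrow> q x < q y"
      using L(1) by (auto simp: q'_def)
  next
    fix s x y
    show "q' (Top s x) < q' (Top s y) \<longleftrightarrow> qW x < qW y"
      by (simp add: q'_def)
  next
    fix s g i x assume g: "g \<in> W"
    have "q' (Copy i x) < q' (Top s g)" if "h i + q x < \<theta> s"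
      using lo[OF that g] by (simp add: q'_def)
    moreover have "q' (Top s g) < q' (Copy i x)" if "\<theta> s \<le> h i + q x"
      using hi[OF that g] by (simp add: q'_def)
    ultimately show "q' (Copy i x) < q' (Top s g) \<longleftrightarrow> h i + q x < \<theta> s"
      and "q' (Top s g) < q' (Copy i x) \<longleftrightarrow> \<theta> s \<le> h i + q x"
      by linarith+
  qed
  then show ?thesis using that by blast
qed

text \<open>Only paths from a new vertex through two old ones need \<open>cl\<close>, whose
  disjunction says that the first edge goes up or the second goes down. All others are short-cut in
  \<open>E\<close>, in \<open>F\<close>, or through the common neighbourhood of a block. The shift
  \<open>D\<close> puts new vertices to the left of old ones.\<close>

lemma oriented_magical_ext:
  assumes H: "oriented_magical V p q E"
    and W: "oriented_magical W pW qW F"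
    and q': "placement W h \<theta> q qW q'"
    and D: "\<And>g x. g \<in> W \<Longrightarrow> x \<in> V \<Longrightarrow> pW g < p x + D"
    and U: "\<And>s. s < M \<Longrightarrow> U s \<subseteq> {..<m} \<times> V"
    and cl: "\<And>s i x y. s < M \<Longrightarrow> (i, x) \<in> U s \<Longrightarrow> (x, y) \<in> E \<Longrightarrow>
               \<theta> s \<le> h i + q x \<or> q y < q x \<Longrightarrow> (i, y) \<in> U s"
    and p'_def: "p' = (\<lambda>v. case v of Point \<Rightarrow> 0 | Copy i x \<Rightarrow> p x + D | Top s g \<Rightarrow> pW g)"
  shows "oriented_magical (ext_verts m M V W) p' q' (ext m M W U E F)"
proof -
  note E = oriented_magicalD[OF H] and F = oriented_magicalD[OF W]
  note Q = placementD[OF q']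
  show ?thesis
    unfolding oriented_magical_def
  proof (intro conjI allI impI)
    show "ext m M W U E F \<subseteq> ext_verts m M V W \<times> ext_verts m M V W"
    proof
      fix e assume e: "e \<in> ext m M W U E F"
      have "(i, x) \<in> U s \<Longrightarrow> s < M \<Longrightarrow> i < m \<and> x \<in> V" for i x s
        using U[of s] by auto
      then show "e \<in> ext_verts m M V W \<times> ext_verts m M V W"
        using e E(1) F(1) unfolding ext_def by (auto dest: subsetD)
    qed
  next
    fix a b assume ab: "(a, b) \<in> ext m M W U E F"
    have "p' a < p' b \<and> (q' a < q' b \<or> q' b < q' a)"
    proof (cases a)
      case Point
      then show ?thesis using ab by simp
    next
      case a: (Copy i x)
      with ab obtain y where b: "b = Copy i y" "(x, y) \<in> E" by (cases b) auto
      show ?thesis using a b E(2)[OF b(2)] by (auto simp: Q p'_def)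
    next
      case a: (Top s g)
      show ?thesis
      proof (cases b)
        case Point
        then show ?thesis using ab by simp
      next
        case b: (Copy i x)
        have "s < M" "g \<in> W" "(i, x) \<in> U s" using ab a b by auto
        then have "x \<in> V" using U by blast
        then show ?thesis using a b D[OF \<open>g \<in> W\<close>] Q(3,4)[OF \<open>g \<in> W\<close>] by (auto simp: p'_def)
      next
        case b: (Top t h)
        then have "t = s" "(g, h) \<in> F" using ab a by auto
        then show ?thesis using a b F(2)[of g h] by (auto simp: Q p'_def)
      qed
    qed
    then show "p' a < p' b" "q' a \<noteq> q' b" by auto
  next
    fix a b c
    assume ab: "(a, b) \<in> ext m M W U E F" and bc: "(b, c) \<in> ext m M W U E F"
      and q: "q' a < q' b \<or> q' c < q' b"
    show "(a, c) \<in> ext m M W U E F"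
    proof (cases a)
      case Point
      then show ?thesis using ab by simp
    next
      case a: (Copy i x)
      obtain y where b: "b = Copy i y" "(x, y) \<in> E" "i < m" using a ab by (cases b) auto
      obtain z where c: "c = Copy i z" "(y, z) \<in> E" using b bc by (cases c) auto
      show ?thesis using a b c q E(3)[OF b(2) c(2)] by (simp add: Q)
    next
      case a: (Top s g)
      show ?thesis
      proof (cases b)
        case Point
        then show ?thesis using ab by simp
      next
        case b: (Copy i x)
        obtain y where c: "c = Copy i y" "(x, y) \<in> E" using b bc by (cases c) auto
        have *: "s < M" "g \<in> W" "(i, x) \<in> U s" using ab a b by auto
        then show ?thesis using a b c q cl[OF *(1,3) c(2)] by (simp add: Q)
      next
        case b: (Top t h)
        have *: "t = s" "(g, h) \<in> F" "s < M" using ab a b by auto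
        then have "g \<in> W" using F(1) by blast
        show ?thesis
        proof (cases c)
          case Point
          then show ?thesis using bc by simp
        next
          case (Copy i x)
          then show ?thesis using a b * bc \<open>g \<in> W\<close> by simp
        next
          case c: (Top u k)
          then have "(h, k) \<in> F" "u = s" using b * bc by auto
          then show ?thesis using a b c q * F(3)[OF *(2)] by (simp add: Q)
        qed
      qed
    qed
  qed
qed

lemma bimagical_ext:
  assumes H: "bimagical V p q r E1 E2" and W: "bimagical W pW qW rW F1 F2"
    and U: "\<And>s. s < M \<Longrightarrow> U1 s \<subseteq> {..<m} \<times> V" "\<And>s. s < M \<Longrightarrow> U2 s \<subseteq> {..<m} \<times> V"
    and cl1: "\<And>s i x y. s < M \<Longrightarrow> (i, x) \<in> U1 s \<Longrightarrow> (x, y) \<in> E1 \<Longrightarrow>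
               \<theta>1 s \<le> h1 i + q x \<or> q y < q x \<Longrightarrow> (i, y) \<in> U1 s"
    and cl2: "\<And>s i x y. s < M \<Longrightarrow> (i, x) \<in> U2 s \<Longrightarrow> (x, y) \<in> E2 \<Longrightarrow>
               \<theta>2 s \<le> h2 i + r x \<or> r y < r x \<Longrightarrow> (i, y) \<in> U2 s"
  obtains p' q' r' where
    "bimagical (ext_verts m M V W) p' q' r' (ext m M W U1 E1 F1) (ext m M W U2 E2 F2)"
    "placement W h1 \<theta>1 q qW q'" "placement W h2 \<theta>2 r rW r'"
proof -
  have fin: "finite V" "finite W" using H W unfolding bimagical_def by auto
  obtain q' where q': "placement W h1 \<theta>1 q qW q'" using ex_placement[OF fin(2)] .
  obtain r' where r': "placement W h2 \<theta>2 r rW r'" using ex_placement[OF fin(2)] .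
  obtain L :: int where L: "L > 0" "\<And>x. x \<in> V \<Longrightarrow> \<bar>p x\<bar> < L"
    using finite_int_bound[OF fin(1)] by blast
  obtain K :: int where K: "K > 0" "\<And>x. x \<in> W \<Longrightarrow> \<bar>pW x\<bar> < K"
    using finite_int_bound[OF fin(2)] by blast
  have D: "pW g < p x + (L + K)" if "g \<in> W" "x \<in> V" for g x
    using L(2)[OF that(2)] K(2)[OF that(1)] by linarith
  have "bimagical (ext_verts m M V W)
     (\<lambda>v. case v of Point \<Rightarrow> 0 | Copy i x \<Rightarrow> p x + (L + K) | Top s g \<Rightarrow> pW g) q' r'
     (ext m M W U1 E1 F1) (ext m M W U2 E2 F2)"
    unfolding bimagical_def
  proof (intro conjI)
    show "finite (ext_verts m M V W)" using fin by (rule finite_ext_verts)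
  next
    show "oriented_magical (ext_verts m M V W)
       (\<lambda>v. case v of Point \<Rightarrow> 0 | Copy i x \<Rightarrow> p x + (L + K) | Top s g \<Rightarrow> pW g) q' (ext m M W U1 E1 F1)"
      by (rule oriented_magical_ext[OF _ _ q' _ U(1) cl1 refl])
        (use H W D in \<open>auto simp: bimagical_def\<close>)
  next
    show "oriented_magical (ext_verts m M V W)
       (\<lambda>v. case v of Point \<Rightarrow> 0 | Copy i x \<Rightarrow> p x + (L + K) | Top s g \<Rightarrow> pW g) r' (ext m M W U2 E2 F2)"
      by (rule oriented_magical_ext[OF _ _ r' _ U(2) cl2 refl])
        (use H W D in \<open>auto simp: bimagical_def\<close>)
  qed
  then show ?thesis using that q' r' by blast
qed

text \<open>There are no edges between different copies or between different blocks, so a clique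
  meets at most one of each.\<close>

lemma dclique_ext_cases:
  assumes X: "X \<subseteq> ext_verts m M V W" "dclique X (ext m M W U E F)"
  obtains (base) i Z where "X = Copy i ` Z" "Z \<subseteq> V" "dclique Z E"
    | (top) s Y i Z where "s < M" "X = Top s ` Y \<union> Copy i ` Z" "Y \<noteq> {}" "Y \<subseteq> W" "dclique Y F"
        "Z \<subseteq> V" "dclique Z E" "\<And>x. x \<in> Z \<Longrightarrow> (i, x) \<in> U s"
proof -
  have adj: "(x, y) \<in> ext m M W U E F \<or> (y, x) \<in> ext m M W U E F"
    if "x \<in> X" "y \<in> X" "x \<noteq> y" for x y
    using X(2) that unfolding dclique_def by blast
  have noP: "Point \<notin> X" using X(1) by auto
  obtain i where i: "\<And>j x. Copy j x \<in> X \<Longrightarrow> j = i"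
  proof (cases "\<exists>j x. Copy j x \<in> X")
    case True
    then obtain j x where jx: "Copy j x \<in> X" by blast
    have "j' = j" if "Copy j' x' \<in> X" for j' x'
      using adj[OF jx that] by auto
    then show ?thesis using that by blast
  next
    case False
    then show ?thesis using that by blast
  qed
  define Z where "Z = {x. Copy i x \<in> X}"
  have Z: "Z \<subseteq> V" "dclique Z E"
  proof -
    show "Z \<subseteq> V" using X(1) unfolding Z_def by auto
    have "(x, y) \<in> E \<or> (y, x) \<in> E" if "x \<in> Z" "y \<in> Z" "x \<noteq> y" for x y
      using adj[of "Copy i x" "Copy i y"] that by (auto simp: Z_def)
    then show "dclique Z E" unfolding dclique_def by blast
  qed
  show ?thesis
  proof (cases "\<exists>s g. Top s g \<in> X")
    case False
    have "X = Copy i ` Z"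
    proof (intro equalityI subsetI)
      fix v assume v: "v \<in> X"
      show "v \<in> Copy i ` Z"
      proof (cases v)
        case (Copy j x)
        then show ?thesis using v i[of j x] by (auto simp: Z_def)
      qed (use v False noP in auto)
    qed (auto simp: Z_def)
    then show ?thesis using base Z by blast
  next
    case True
    then obtain s g where sg: "Top s g \<in> X" by blast
    define Y where "Y = {x. Top s x \<in> X}"
    have s: "s' = s" if "Top s' x' \<in> X" for s' x'
      using adj[OF sg that] by auto
    have "X = Top s ` Y \<union> Copy i ` Z"
    proof (intro equalityI subsetI)
      fix v assume v: "v \<in> X"
      show "v \<in> Top s ` Y \<union> Copy i ` Z"
      proof (cases v)
        case (Copy j x)
        then show ?thesis using v i[of j x] by (auto simp: Z_def)
      next
        case (Top s' x)
        then show ?thesis using v s[of s' x] by (auto simp: Y_def)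
      qed (use v noP in auto)
    qed (auto simp: Z_def Y_def)
    moreover have "(i, x) \<in> U s" if "x \<in> Z" for x
      using adj[OF sg, of "Copy i x"] that by (auto simp: Z_def)
    moreover have "Y \<noteq> {}" "Y \<subseteq> W" "s < M" using sg X(1) by (auto simp: Y_def)
    moreover have "dclique Y F"
    proof -
      have "(x, y) \<in> F \<or> (y, x) \<in> F" if "x \<in> Y" "y \<in> Y" "x \<noteq> y" for x y
        using adj[of "Top s x" "Top s y"] that by (auto simp: Y_def)
      then show ?thesis unfolding dclique_def by blast
    qed
    ultimately show ?thesis using top Z by metis
  qed
qed

section \<open>Joins along transversals\<close>

text \<open>For \<open>n \<ge> N\<close> the last two conditions say that the chromatic number is
  exactly \<open>N\<close>.\<close>

definition extremal ::
  "nat \<Rightarrow> nat \<Rightarrow> nat \<Rightarrow> 'a set \<Rightarrow> ('a \<Rightarrow> int) \<Rightarrow> ('a \<Rightarrow> int) \<Rightarrow> ('a \<Rightarrow> int) \<Rightarrow>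
   'a rel \<Rightarrow> 'a rel \<Rightarrow> bool" where
  "extremal n k N V p q r E1 E2 \<longleftrightarrow> bimagical V p q r E1 E2 \<and> clique_le V (E1 \<inter> E2) k \<and>
     forces n V (E1 \<inter> E2) N \<and> colourable V (E1 \<inter> E2) N"

lemma extremal_mirror:
  "extremal n k N V p q r E1 E2 \<Longrightarrow> extremal n k N V (\<lambda>x. - p x) q r (E1\<inverse>) (E2\<inverse>)"
  unfolding extremal_def converse_Int[symmetric] by (simp add: bimagical_mirror)

text \<open>Greedy choice: the last set has more elements than there are representatives chosen
  before it.\<close>

lemma distinct_representatives:
  fixes C :: "nat \<Rightarrow> 'a set"
  assumes "\<And>i. i < T \<Longrightarrow> i < card (C i)"
  shows "\<exists>c. inj_on c {..<T} \<and> (\<forall>i<T. c i \<in> C i)"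
  using assms
proof (induction T)
  case (Suc T)
  then obtain c where c: "inj_on c {..<T}" "\<forall>i<T. c i \<in> C i" by force
  have "card (c ` {..<T}) < card (C T)"
    using c(1) Suc.prems[of T] by (simp add: card_image)
  then obtain a where a: "a \<in> C T" "a \<notin> c ` {..<T}"
    by (metis card_mono finite_imageI finite_lessThan linorder_not_le subsetI)
  have "inj_on (c(T := a)) {..<Suc T}"
    using c(1) a(2) by (auto simp: inj_on_def less_Suc_eq)
  moreover have "\<forall>i<Suc T. (c(T := a)) i \<in> C i"
    using c(2) a(1) by (auto simp: less_Suc_eq)
  ultimately show ?case by blast
qed auto

lemma proper_Copy:
  assumes "proper (ext m M W U E F) f" "i < m"
  shows "proper E (\<lambda>x. f (Copy i x))"
  using assms unfolding proper_def by force

lemma proper_Top: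
  assumes "proper (ext m M W U E F) f" "s < M"
  shows "proper F (\<lambda>x. f (Top s x))"
  using assms unfolding proper_def by force

text \<open>Copies and blocks receive disjoint palettes, the second one shifted by \<open>T\<close>,
  so edges between them are properly coloured automatically.\<close>

lemma colourable_ext:
  assumes "colourable V E T" "colourable W F N" "E \<subseteq> V \<times> V" "\<And>s. s < M \<Longrightarrow> U s \<subseteq> {..<m} \<times> V"
  shows "colourable (ext_verts m M V W) (ext m M W U E F) (T + N)"
proof -
  obtain f where f: "f ` V \<subseteq> {..<T}" "proper E f" using assms(1) unfolding colourable_def by blast
  obtain g where g: "g ` W \<subseteq> {..<N}" "proper F g" using assms(2) unfolding colourable_def by blast
  define c where "c v = (case v of Point \<Rightarrow> 0 | Copy i x \<Rightarrow> f x | Top s x \<Rightarrow> T + g x)" for v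
  have "c ` ext_verts m M V W \<subseteq> {..<T + N}"
    using f(1) g(1) by (fastforce simp: ext_verts_def c_def)
  moreover have "proper (ext m M W U E F) c"
    unfolding proper_def
  proof (intro allI impI)
    fix a b assume ab: "(a, b) \<in> ext m M W U E F"
    show "c a \<noteq> c b"
    proof (cases a)
      case a: (Copy i x)
      then obtain y where "b = Copy i y" "(x, y) \<in> E" using ab by (cases b) auto
      then show ?thesis using a f(2) by (simp add: c_def proper_def)
    next
      case a: (Top s x)
      show ?thesis
      proof (cases b)
        case b: (Copy i y)
        then have "(i, y) \<in> U s" "s < M" using ab a by auto
        then have "y \<in> V" using assms(4) by blast
        then have "f y < T" using f(1) by auto
        then show ?thesis using a b by (simp add: c_def)
      next
        case b: (Top t y)
        then show ?thesis using ab a g(2) by (simp add: c_def proper_def)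
      qed (use ab in auto)
    qed (use ab in auto)
  qed
  ultimately show ?thesis unfolding colourable_def by blast
qed

lemma finite_enumeration:
  assumes "finite A"
  obtains M :: nat and f where "f ` {..<M} = A"
  using assms finite_imp_nat_seg_image_inj_on[OF assms] that unfolding lessThan_def by metis

text \<open>The set of neighbours in copy \<open>i\<close> has to be closed under edges that go down, separately in the
  two magical graphs; as no edge goes down in both, the two closures of a vertex \<open>\<sigma> s i\<close> have only
  this vertex in common.\<close>

lemma extremal_join:
  fixes V W :: "vertex set"
  assumes H: "extremal n (Suc k) T V p q r E1 E2" and nd: "no_down q r (E1 \<inter> E2)"
    and K: "extremal n k N W pW qW rW F1 F2" and T: "T > 0"
  obtains V' p' q' r' and E1' E2' :: "vertex rel" where
    "extremal n (Suc k) (T + N) V' p' q' r' E1' E2'"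
    "no_up q r (E1 \<inter> E2) \<longrightarrow> no_up qW rW (F1 \<inter> F2) \<longrightarrow> no_up q' r' (E1' \<inter> E2')"
    "\<forall>X\<subseteq>W. dclique X (F1 \<inter> F2) \<longrightarrow>
       (\<exists>X'\<subseteq>V'. dclique X' (E1' \<inter> E2') \<and> card X' = Suc (card X))"
proof -
  have bH: "bimagical V p q r E1 E2" and bK: "bimagical W pW qW rW F1 F2"
    and clH: "clique_le V (E1 \<inter> E2) (Suc k)" and clK: "clique_le W (F1 \<inter> F2) k"
    and foH: "forces n V (E1 \<inter> E2) T" and foK: "forces n W (F1 \<inter> F2) N"
    and coH: "colourable V (E1 \<inter> E2) T" and coK: "colourable W (F1 \<inter> F2) N"
    using H K unfolding extremal_def by blast+
  have fin: "finite V" "finite W" and om: "oriented_magical V p q E1" "oriented_magical V p r E2"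
    using bH bK unfolding bimagical_def by auto
  have "V \<noteq> {}"
    using foH coH T unfolding forces_def colourable_def
    by (metis card.empty empty_subsetI image_empty not_le)
  \<comment> \<open>There will be \<open>T\<close> copies of the old graph and one block for every
    way \<open>\<sigma> s\<close> of picking one vertex from each copy.\<close>
  have "finite ({..<T} \<rightarrow>\<^sub>E V)" using fin by (simp add: finite_PiE)
  then obtain M :: nat and \<sigma> where \<sigma>: "\<sigma> ` {..<M} = {..<T} \<rightarrow>\<^sub>E V" by (rule finite_enumeration)
  have \<sigma>V: "\<sigma> s i \<in> V" if "s < M" "i < T" for s i
    using \<sigma> that by (metis PiE_mem imageI lessThan_iff)
  have "M > 0"
    using \<sigma> \<open>V \<noteq> {}\<close> by (metis PiE_eq_empty_iff gr0I image_empty lessThan_0)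
  \<comment> \<open>Used as heights of the blocks, these bounds make every edge from a block to a
    copy go down in both orders. So only the closure under down edges remains to be checked.\<close>
  obtain L1 :: int where L1: "\<And>x. x \<in> V \<Longrightarrow> \<bar>q x\<bar> < L1" using finite_int_bound[OF fin(1)] by blast
  obtain L2 :: int where L2: "\<And>x. x \<in> V \<Longrightarrow> \<bar>r x\<bar> < L2" using finite_int_bound[OF fin(1)] by blast
  have L: "q x < L1" "r x < L2" if "x \<in> V" for x using L1[OF that] L2[OF that] by auto
  define U1 where "U1 s = {(i, y). i < T \<and> y \<in> down E1 q (\<sigma> s i)}" for s
  define U2 where "U2 s = {(i, y). i < T \<and> y \<in> down E2 r (\<sigma> s i)}" for s
  have U1V: "U1 s \<subseteq> {..<T} \<times> V" if "s < M" for s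
    using down_subset[OF om(1)] \<sigma>V[OF that] unfolding U1_def by fastforce
  have U2V: "U2 s \<subseteq> {..<T} \<times> V" if "s < M" for s
    using down_subset[OF om(2)] \<sigma>V[OF that] unfolding U2_def by fastforce
  have U: "(i, y) \<in> U1 s \<inter> U2 s \<longleftrightarrow> i < T \<and> y = \<sigma> s i" for i y s
    using nd unfolding U1_def U2_def down_def no_down_def by auto
  have cl1: "(i, y) \<in> U1 s"
    if "s < M" "(i, x) \<in> U1 s" "(x, y) \<in> E1" "L1 \<le> 0 + q x \<or> q y < q x" for s i x y
  proof -
    have "x \<in> V" using U1V that(1,2) by blast
    then have "q y < q x" using that(4) L(1)[of x] by auto
    then show ?thesis using that(2,3) down_closed[OF om(1)] unfolding U1_def by blast
  qed
  have cl2: "(i, y) \<in> U2 s"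
    if "s < M" "(i, x) \<in> U2 s" "(x, y) \<in> E2" "L2 \<le> 0 + r x \<or> r y < r x" for s i x y
  proof -
    have "x \<in> V" using U2V that(1,2) by blast
    then have "r y < r x" using that(4) L(2)[of x] by auto
    then show ?thesis using that(2,3) down_closed[OF om(2)] unfolding U2_def by blast
  qed
  obtain p' q' r' where b': "bimagical (ext_verts T M V W) p' q' r' (ext T M W U1 E1 F1) (ext T M W U2 E2 F2)"
    and q': "placement W (\<lambda>_. 0) (\<lambda>_. L1) q qW q'"
    and r': "placement W (\<lambda>_. 0) (\<lambda>_. L2) r rW r'"
    using bimagical_ext[OF bH bK U1V U2V cl1 cl2] .
  define U' where "U' s = U1 s \<inter> U2 s" for s
  have E': "ext T M W U1 E1 F1 \<inter> ext T M W U2 E2 F2 = ext T M W U' (E1 \<inter> E2) (F1 \<inter> F2)"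
    unfolding U'_def by (rule ext_Int)
  have U': "(i, y) \<in> U' s \<longleftrightarrow> i < T \<and> y = \<sigma> s i" for i y s
    using U by (simp add: U'_def)
  have "clique_le (ext_verts T M V W) (ext T M W U' (E1 \<inter> E2) (F1 \<inter> F2)) (Suc k)"
    unfolding clique_le_def
  proof (intro allI impI)
    fix X assume X: "X \<subseteq> ext_verts T M V W" "dclique X (ext T M W U' (E1 \<inter> E2) (F1 \<inter> F2))"
    from X show "card X \<le> Suc k"
    proof (cases rule: dclique_ext_cases)
      case (base i Z)
      then have "finite Z" "card Z \<le> Suc k"
        using fin(1) finite_subset clH unfolding clique_le_def by blast+
      then show ?thesis unfolding base(1) using card_image_le le_trans by blast
    next
      case (top s Y i Z)
      have "finite Y" using top(4) fin(2) by (rule finite_subset)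
      then have "card (Top s ` Y) \<le> card Y" by (rule card_image_le)
      also have "card Y \<le> k" using top clK unfolding clique_le_def by blast
      finally have "card (Top s ` Y) \<le> k" .
      \<comment> \<open>A block sees just one vertex of each copy, so its cliques grow by at most
        one.\<close>
      moreover have "Copy i ` Z \<subseteq> {Copy i (\<sigma> s i)}" using top(8) U' by blast
      then have "card (Copy i ` Z) \<le> card {Copy i (\<sigma> s i)}" by (intro card_mono) auto
      ultimately show ?thesis
        unfolding top(2) using card_Un_le[of "Top s ` Y" "Copy i ` Z"] by simp
    qed
  qed
  moreover have "forces n (ext_verts T M V W) (ext T M W U' (E1 \<inter> E2) (F1 \<inter> F2)) (T + N)"
    unfolding forces_def
  proof (intro allI impI)
    fix f :: "vertex \<Rightarrow> nat" assume f: "f ` ext_verts T M V W \<subseteq> {..<n}"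
      "proper (ext T M W U' (E1 \<inter> E2) (F1 \<inter> F2)) f"
    have fn: "f v < n" if "v \<in> ext_verts T M V W" for v using f(1) that by blast
    \<comment> \<open>Each copy uses at least \<open>T\<close> colours, so the \<open>T\<close>
      copies have distinct representatives \<open>c i\<close>. The block whose transversal carries
      these colours has to avoid them all, and uses \<open>N\<close> further ones.\<close>
    have "T \<le> card ((\<lambda>x. f (Copy i x)) ` V)" if "i < T" for i
    proof -
      have "(\<lambda>x. f (Copy i x)) ` V \<subseteq> {..<n}" using that by (auto intro!: fn)
      then show ?thesis using foH proper_Copy[OF f(2) that] unfolding forces_def by blast
    qed
    then obtain c where c: "inj_on c {..<T}" "\<forall>i<T. c i \<in> (\<lambda>x. f (Copy i x)) ` V"
      using distinct_representatives[of T "\<lambda>i. (\<lambda>x. f (Copy i x)) ` V"] by fastforce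
    then obtain x where x: "\<And>i. i < T \<Longrightarrow> x i \<in> V \<and> f (Copy i (x i)) = c i"
      unfolding image_iff by metis
    have "restrict x {..<T} \<in> {..<T} \<rightarrow>\<^sub>E V" using x by auto
    then obtain s where s: "s < M" "\<sigma> s = restrict x {..<T}" using \<sigma> by (metis imageE lessThan_iff)
    have "(\<lambda>g. f (Top s g)) ` W \<subseteq> {..<n}" using s(1) by (auto intro!: fn)
    then have N: "N \<le> card ((\<lambda>g. f (Top s g)) ` W)"
      using foK proper_Top[OF f(2) s(1)] unfolding forces_def by blast
    have "f (Top s g) \<noteq> c i" if "g \<in> W" "i < T" for g i
    proof -
      have "(Top s g, Copy i (x i)) \<in> ext T M W U' (E1 \<inter> E2) (F1 \<inter> F2)"
        using that s U' by simp
      then show ?thesis using f(2) x that unfolding proper_def by metis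
    qed
    then have "c ` {..<T} \<inter> (\<lambda>g. f (Top s g)) ` W = {}" by force
    then have "T + card ((\<lambda>g. f (Top s g)) ` W) = card (c ` {..<T} \<union> (\<lambda>g. f (Top s g)) ` W)"
      using fin c(1) by (simp add: card_Un_disjoint card_image)
    also have "\<dots> \<le> card (f ` ext_verts T M V W)"
    proof (rule card_mono)
      show "finite (f ` ext_verts T M V W)" using fin by (simp add: finite_ext_verts)
      have "c i \<in> f ` ext_verts T M V W" if "i < T" for i
      proof -
        have "Copy i (x i) \<in> ext_verts T M V W" using x that by simp
        then show ?thesis using x[OF that] by (metis imageI)
      qed
      then show "c ` {..<T} \<union> (\<lambda>g. f (Top s g)) ` W \<subseteq> f ` ext_verts T M V W"
        using s(1) by auto
    qed
    finally show "T + N \<le> card (f ` ext_verts T M V W)" using N by linarith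
  qed
  moreover have "colourable (ext_verts T M V W) (ext T M W U' (E1 \<inter> E2) (F1 \<inter> F2)) (T + N)"
  proof (rule colourable_ext[OF coH coK])
    show "E1 \<inter> E2 \<subseteq> V \<times> V" using oriented_magicalD(1)[OF om(1)] by blast
    show "U' s \<subseteq> {..<T} \<times> V" if "s < M" for s using U1V[OF that] unfolding U'_def by blast
  qed
  ultimately have "extremal n (Suc k) (T + N) (ext_verts T M V W) p' q' r'
      (ext T M W U1 E1 F1) (ext T M W U2 E2 F2)"
    unfolding extremal_def E' using b' by blast
  moreover have "no_up q' r' (ext T M W U1 E1 F1 \<inter> ext T M W U2 E2 F2)"
    if nu: "no_up q r (E1 \<inter> E2)" "no_up qW rW (F1 \<inter> F2)"
    unfolding no_up_def E'
  proof (intro allI impI)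
    fix a b assume ab: "(a, b) \<in> ext T M W U' (E1 \<inter> E2) (F1 \<inter> F2)"
    show "\<not> (q' a < q' b \<and> r' a < r' b)"
    proof (cases a)
      case a: (Copy i x)
      then obtain y where b: "b = Copy i y" "(x, y) \<in> E1 \<inter> E2" using ab by (cases b) auto
      have "q' a < q' b \<longleftrightarrow> q x < q y" "r' a < r' b \<longleftrightarrow> r x < r y"
        using a b(1) by (simp_all add: placementD[OF q'] placementD[OF r'])
      then show ?thesis using nu(1) b(2) unfolding no_up_def by blast
    next
      case a: (Top s x)
      show ?thesis
      proof (cases b)
        case b: (Copy i y)
        then have "x \<in> W" "y \<in> V" using ab a U' \<sigma>V by auto
        then have "q' b < q' a" using L a b by (simp add: placementD[OF q'])
        then show ?thesis by simp
      next
        case b: (Top t y)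
        then have "t = s" "(x, y) \<in> F1 \<inter> F2" using ab a by auto
        moreover have "q' (Top s x) < q' (Top s y) \<longleftrightarrow> qW x < qW y"
          "r' (Top s x) < r' (Top s y) \<longleftrightarrow> rW x < rW y"
          by (simp_all add: placementD[OF q'] placementD[OF r'])
        ultimately show ?thesis using nu(2) a b unfolding no_up_def by blast
      qed (use ab in auto)
    qed (use ab in auto)
  qed
  moreover have "\<exists>X'. X' \<subseteq> ext_verts T M V W \<and>
      dclique X' (ext T M W U1 E1 F1 \<inter> ext T M W U2 E2 F2) \<and> card X' = Suc (card X)"
    if X: "X \<subseteq> W" "dclique X (F1 \<inter> F2)" for X
  \<comment> \<open>The clique is taken in block \<open>0\<close> and extended by the vertex this
    block sees in copy \<open>0\<close>; both exist because \<open>M\<close> and \<open>T\<close>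
    are positive.\<close>
  proof (intro exI[of _ "insert (Copy 0 (\<sigma> 0 0)) (Top 0 ` X)"] conjI)
    show "insert (Copy 0 (\<sigma> 0 0)) (Top 0 ` X) \<subseteq> ext_verts T M V W"
      using X(1) \<open>M > 0\<close> T \<sigma>V by auto
    have "(Top 0 x, Copy 0 (\<sigma> 0 0)) \<in> ext T M W U' (E1 \<inter> E2) (F1 \<inter> F2)" if "x \<in> X" for x
      using that X(1) \<open>M > 0\<close> T U' by auto
    moreover have "(Top 0 x, Top 0 y) \<in> ext T M W U' (E1 \<inter> E2) (F1 \<inter> F2) \<or>
        (Top 0 y, Top 0 x) \<in> ext T M W U' (E1 \<inter> E2) (F1 \<inter> F2)"
      if "x \<in> X" "y \<in> X" "x \<noteq> y" for x y
      using that X(2) \<open>M > 0\<close> unfolding dclique_def by (auto simp del: Int_iff)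
    ultimately show "dclique (insert (Copy 0 (\<sigma> 0 0)) (Top 0 ` X))
        (ext T M W U1 E1 F1 \<inter> ext T M W U2 E2 F2)"
      unfolding E' dclique_def by blast
    have "finite X" using X(1) fin(2) finite_subset by blast
    moreover have "card (Top 0 ` X) = card X" by (rule card_image) (simp add: inj_on_def)
    ultimately show "card (insert (Copy 0 (\<sigma> 0 0)) (Top 0 ` X)) = Suc (card X)"
      by (subst card_insert_disjoint) auto
  qed
  ultimately show ?thesis using that by blast
qed

section \<open>Forcing quadratically many colours\<close>

text \<open>The rank \<open>(b, c)\<close> of a vertex is encoded as the number \<open>b * k + c\<close>, so that the lexicographic
  order of ranks is the order of the natural numbers.\<close>

definition ranked ::
  "nat \<Rightarrow> nat \<Rightarrow> nat \<Rightarrow> 'a set \<Rightarrow> ('a \<Rightarrow> int) \<Rightarrow> ('a \<Rightarrow> int) \<Rightarrow> ('a \<Rightarrow> int) \<Rightarrow>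
   'a rel \<Rightarrow> 'a rel \<Rightarrow> ('a \<Rightarrow> nat) \<Rightarrow> bool" where
  "ranked n k j V p q r E1 E2 \<rho> \<longleftrightarrow> bimagical V p q r E1 E2 \<and>
     no_up q r (E1 \<inter> E2) \<and> no_down q r (E1 \<inter> E2) \<and>
     clique_le V (E1 \<inter> E2) k \<and> colourable V (E1 \<inter> E2) j \<and>
     (\<forall>x\<in>V. clique_le (down E2 r x) (E1 \<inter> E2) (Suc (\<rho> x div k)) \<and>
            clique_le (down E1 q x) (E1 \<inter> E2) (Suc (\<rho> x mod k))) \<and>
     (\<forall>f. f ` V \<subseteq> {..<n} \<longrightarrow> proper (E1 \<inter> E2) f \<longrightarrow>
        (\<exists>\<phi>. (\<forall>i<j. \<phi> i \<in> V \<and> \<rho> (\<phi> i) = i) \<and> inj_on (\<lambda>i. f (\<phi> i)) {..<j}))"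

lemma ranked_empty: "ranked n k 0 ({} :: 'a set) (\<lambda>_. 0) (\<lambda>_. 0) (\<lambda>_. 0) {} {} (\<lambda>_. 0)"
  unfolding ranked_def bimagical_def oriented_magical_def no_up_def no_down_def clique_le_def
    colourable_def proper_def by auto

section \<open>Two selection principles for the colouring argument\<close>

lemma large_fibre:
  assumes "finite A" "finite B" "f ` A \<subseteq> B" "card B * c < card A"
  obtains y where "y \<in> B" "c < card {x \<in> A. f x = y}"
proof (rule ccontr)
  assume "\<not> thesis"
  then have small: "card {x \<in> A. f x = y} \<le> c" if "y \<in> B" for y
    using \<open>y \<in> B\<close> \<open>\<And>y. y \<in> B \<Longrightarrow> c < card {x \<in> A. f x = y} \<Longrightarrow> thesis\<close> not_le by blast
  have "A = (\<Union>y\<in>B. {x \<in> A. f x = y})" using assms(3) by auto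
  then have "card A \<le> (\<Sum>y\<in>B. card {x \<in> A. f x = y})"
    using card_UN_le[OF assms(2), of "\<lambda>y. {x \<in> A. f x = y}"] by simp
  also have "\<dots> \<le> card B * c" using sum_mono[of B _ "\<lambda>_. c", OF small] by simp
  finally show False using assms(4) by simp
qed

lemma increasing_selection:
  assumes "finite (J :: nat set)"
  obtains e where "\<And>l. l < card J \<Longrightarrow> e l \<in> J" "\<And>l l'. l < l' \<Longrightarrow> l' < card J \<Longrightarrow> e l < e l'"
proof
  show "sorted_list_of_set J ! l \<in> J" if "l < card J" for l
    using that assms nth_mem[of l "sorted_list_of_set J"] by simp
  show "sorted_list_of_set J ! l < sorted_list_of_set J ! l'" if "l < l'" "l' < card J" for l l'
    using that assms sorted_wrt_nth_less[OF strict_sorted_list_of_set, of l l' J] by simp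
qed

text \<open>The new vertex with index \<open>s\<close> is inserted in \<open><\<^sub>2\<close> above the copies \<open>i < t s\<close> and below the others,
  and the other way round in \<open><\<^sub>3\<close>. Its neighbours are selected by \<open>S s\<close>, at most one in each copy
  up to closure. By the pigeonhole principle, a colouring uses the same colours on the ranks of
  more than \<open>2 * j\<close> copies, so that for each earlier rank there is a copy on the side of the threshold on
  which this rank can be seen.\<close>

lemma ranked_step:
  fixes V :: "vertex set"
  assumes R: "ranked n k j V p q r E1 E2 \<rho>" and j: "j < k * k"
  obtains V' p' q' r' and E1' E2' :: "vertex rel" and \<rho>' where
    "ranked n k (Suc j) V' p' q' r' E1' E2' \<rho>'"
proof -
  have b: "bimagical V p q r E1 E2" and nu: "no_up q r (E1 \<inter> E2)" and nd: "no_down q r (E1 \<inter> E2)"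
    and cl: "clique_le V (E1 \<inter> E2) k" and col: "colourable V (E1 \<inter> E2) j"
    and cl2: "\<And>x. x \<in> V \<Longrightarrow> clique_le (down E2 r x) (E1 \<inter> E2) (Suc (\<rho> x div k))"
    and cl1: "\<And>x. x \<in> V \<Longrightarrow> clique_le (down E1 q x) (E1 \<inter> E2) (Suc (\<rho> x mod k))"
    and fo: "\<And>f. f ` V \<subseteq> {..<n} \<Longrightarrow> proper (E1 \<inter> E2) f \<Longrightarrow>
        \<exists>\<phi>. (\<forall>i<j. \<phi> i \<in> V \<and> \<rho> (\<phi> i) = i) \<and> inj_on (\<lambda>i. f (\<phi> i)) {..<j}"
    using R unfolding ranked_def by blast+
  have fin: "finite V" and om: "oriented_magical V p q E1" "oriented_magical V p r E2"
    using b unfolding bimagical_def by auto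
  \<comment> \<open>The new vertices get rank \<open>(j div k, j mod k)\<close>; both coordinates
    stay below \<open>k\<close> because \<open>j < k * k\<close>.\<close>
  have k: "j div k < k" "j mod k < k" using j by (auto simp: less_mult_imp_div_less intro!: mod_less_divisor gr0I)
  \<comment> \<open>One copy shows at most \<open>n ^ j\<close> colour patterns on its
    \<open>j\<close> ranks, so among this many copies more than \<open>2 * j\<close> share a
    pattern.\<close>
  define m where "m = n ^ j * (2 * j) + 1"
  \<comment> \<open>The admissible choices of threshold and neighbours: a selected vertex must have
    a smaller second rank coordinate than \<open>j\<close> before the threshold, and a smaller first
    one from the threshold on. Being finitely many, all choices can be realised at once.\<close>
  define Ch where "Ch = {(t, S). t \<le> m \<and> S \<subseteq> {..<m} \<times> V \<and> (\<forall>i x y. (i, x) \<in> S \<longrightarrow> (i, y) \<in> S \<longrightarrow> x = y) \<and>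
     (\<forall>i x. (i, x) \<in> S \<longrightarrow> (i < t \<longrightarrow> \<rho> x mod k < j mod k) \<and> (t \<le> i \<longrightarrow> \<rho> x div k < j div k))}"
  have "finite Ch"
  proof (rule finite_subset)
    show "Ch \<subseteq> {..m} \<times> Pow ({..<m} \<times> V)" unfolding Ch_def by auto
  qed (use fin in simp)
  then obtain M :: nat and ch where ch: "ch ` {..<M} = Ch" by (rule finite_enumeration)
  define t where "t s = fst (ch s)" for s
  define S where "S s = snd (ch s)" for s
  have "(t s, S s) \<in> Ch" if "s < M" for s using that ch by (auto simp: t_def S_def)
  then have "t s \<le> m \<and> S s \<subseteq> {..<m} \<times> V \<and> (\<forall>i x y. (i, x) \<in> S s \<longrightarrow> (i, y) \<in> S s \<longrightarrow> x = y) \<and>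
     (\<forall>i x. (i, x) \<in> S s \<longrightarrow> (i < t s \<longrightarrow> \<rho> x mod k < j mod k) \<and> (t s \<le> i \<longrightarrow> \<rho> x div k < j div k))"
    if "s < M" for s
    using that unfolding Ch_def by simp
  then have tS: "t s \<le> m" "S s \<subseteq> {..<m} \<times> V" "\<And>i x y. (i, x) \<in> S s \<Longrightarrow> (i, y) \<in> S s \<Longrightarrow> x = y"
      "\<And>i x. (i, x) \<in> S s \<Longrightarrow> i < t s \<Longrightarrow> \<rho> x mod k < j mod k"
      "\<And>i x. (i, x) \<in> S s \<Longrightarrow> t s \<le> i \<Longrightarrow> \<rho> x div k < j div k" if "s < M" for s
    using that by blast+
  \<comment> \<open>Where new edges go up, closure under all edges is needed, and the whole copy is
    taken; on the other side the down-closure of the selected vertex suffices. The two graphs have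
    opposite sides, so the intersection keeps only one down-closure in each copy.\<close>
  define U1 where "U1 s = {(i, y). i < m \<and> y \<in> V \<and> (t s \<le> i \<or> (\<exists>x. (i, x) \<in> S s \<and> y \<in> down E1 q x))}" for s
  define U2 where "U2 s = {(i, y). i < m \<and> y \<in> V \<and> (i < t s \<or> (\<exists>x. (i, x) \<in> S s \<and> y \<in> down E2 r x))}" for s
  obtain L1 :: int where L1: "L1 > 0" "\<And>x. x \<in> V \<Longrightarrow> \<bar>q x\<bar> < L1" using finite_int_bound[OF fin(1)] by blast
  obtain L2 :: int where L2: "L2 > 0" "\<And>x. x \<in> V \<Longrightarrow> \<bar>r x\<bar> < L2" using finite_int_bound[OF fin(1)] by blast
  \<comment> \<open>Copy \<open>i\<close> lies in the open interval of radius \<open>L1\<close>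
    about \<open>h1 i\<close>, and \<open>\<theta>1 s\<close> is the left end of the interval for
    \<open>i = t s\<close>. The sign in \<open>h2\<close> reverses the order of the copies, so
    \<open>\<theta>2 s\<close> is a right end.\<close>
  define h1 where "h1 i = L1 * (2 * int i)" for i
  define h2 where "h2 i = - (L2 * (2 * int i))" for i
  define \<theta>1 where "\<theta>1 s = L1 * (2 * int (t s)) - L1" for s
  define \<theta>2 where "\<theta>2 s = L2 - L2 * (2 * int (t s))" for s
  have gap: "L * (2 * int i) + L < L * (2 * int i') + y \<and> L * (2 * int i) + y < L * (2 * int i') - L"
    if "i < i'" "\<bar>y\<bar> < L" for i i' :: nat and L y :: int
  proof -
    have "L * (2 * int i + 2) \<le> L * (2 * int i')" using that by (intro mult_left_mono) auto
    moreover have "L * (2 * int i + 2) = L * (2 * int i) + 2 * L" by (simp add: distrib_left)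
    ultimately show ?thesis using that(2) by linarith
  qed
  have t1: "\<theta>1 s \<le> h1 i + q x \<longleftrightarrow> t s \<le> i" if "x \<in> V" for s i x
    using gap[of i "t s" "q x" L1] gap[of "t s" i "q x" L1] L1(2)[OF that]
    unfolding \<theta>1_def h1_def by (cases i "t s" rule: linorder_cases) (auto simp: abs_less_iff)
  have t2: "\<theta>2 s \<le> h2 i + r x \<longleftrightarrow> i < t s" if "x \<in> V" for s i x
    using gap[of i "t s" "r x" L2] gap[of "t s" i "r x" L2] L2(2)[OF that]
    unfolding \<theta>2_def h2_def by (cases i "t s" rule: linorder_cases) (auto simp: abs_less_iff)
  have UV: "U1 s \<subseteq> {..<m} \<times> V" "U2 s \<subseteq> {..<m} \<times> V" for s unfolding U1_def U2_def by auto
  have c1: "(i, y) \<in> U1 s"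
    if "s < M" "(i, x) \<in> U1 s" "(x, y) \<in> E1" "\<theta>1 s \<le> h1 i + q x \<or> q y < q x" for s i x y
  proof -
    have *: "i < m" "x \<in> V" "y \<in> V" using that(2,3) oriented_magicalD(1)[OF om(1)] by (auto simp: U1_def)
    show ?thesis
    proof (cases "t s \<le> i")
      case False
      then have "q y < q x" using that(4) t1[OF *(2)] by blast
      then show ?thesis using False that(2,3) * down_closed[OF om(1)] unfolding U1_def by blast
    qed (use * in \<open>simp add: U1_def\<close>)
  qed
  have c2: "(i, y) \<in> U2 s"
    if "s < M" "(i, x) \<in> U2 s" "(x, y) \<in> E2" "\<theta>2 s \<le> h2 i + r x \<or> r y < r x" for s i x y
  proof -
    have *: "i < m" "x \<in> V" "y \<in> V" using that(2,3) oriented_magicalD(1)[OF om(2)] by (auto simp: U2_def)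
    show ?thesis
    proof (cases "i < t s")
      case False
      then have "r y < r x" using that(4) t2[OF *(2)] by blast
      then show ?thesis using False that(2,3) * down_closed[OF om(2)] unfolding U2_def by blast
    qed (use * in \<open>simp add: U2_def\<close>)
  qed
  have pt: "bimagical {Point} (\<lambda>_. 0) (\<lambda>_. 0) (\<lambda>_. 0) {} {}"
    unfolding bimagical_def oriented_magical_def by simp
  obtain p' q' r' where b': "bimagical (ext_verts m M V {Point}) p' q' r'
        (ext m M {Point} U1 E1 {}) (ext m M {Point} U2 E2 {})"
    and q': "placement {Point} h1 \<theta>1 q (\<lambda>_. 0) q'"
    and r': "placement {Point} h2 \<theta>2 r (\<lambda>_. 0) r'"
    using bimagical_ext[OF b pt UV c1 c2] .
  have Q: "q' (Copy i x) < q' (Copy i y) \<longleftrightarrow> q x < q y"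
     "r' (Copy i x) < r' (Copy i y) \<longleftrightarrow> r x < r y" for i x y
    by (simp_all add: placementD[OF q'] placementD[OF r'])
  have QT: "q' (Copy i x) < q' (Top s Point) \<longleftrightarrow> i < t s" "q' (Top s Point) < q' (Copy i x) \<longleftrightarrow> t s \<le> i"
     "r' (Copy i x) < r' (Top s Point) \<longleftrightarrow> t s \<le> i" "r' (Top s Point) < r' (Copy i x) \<longleftrightarrow> i < t s"
    if "x \<in> V" for i x s
    using t1[OF that, of s i] t2[OF that, of s i]
    by (auto simp: placementD[OF q'] placementD[OF r'])
  define V' where "V' = ext_verts m M V {Point}"
  define E1' where "E1' = ext m M {Point} U1 E1 {}"
  define E2' where "E2' = ext m M {Point} U2 E2 {}"
  define U' where "U' s = U1 s \<inter> U2 s" for s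
  have E': "E1' \<inter> E2' = ext m M {Point} U' (E1 \<inter> E2) {}"
    unfolding U'_def E1'_def E2'_def by (simp add: ext_Int)
  have edge_cases: thesis if "(a, b) \<in> E1' \<inter> E2'"
    "\<And>i x y. a = Copy i x \<Longrightarrow> b = Copy i y \<Longrightarrow> (x, y) \<in> E1 \<inter> E2 \<Longrightarrow> thesis"
    "\<And>s i x. a = Top s Point \<Longrightarrow> b = Copy i x \<Longrightarrow> x \<in> V \<Longrightarrow> thesis" for a b thesis
    using that(1) unfolding E'
    by (cases a; cases b) (use that(2,3) UV in \<open>auto simp: U'_def\<close>)
  define \<rho>' where "\<rho>' v = (case v of Copy i x \<Rightarrow> \<rho> x | _ \<Rightarrow> j)" for v
  have nu': "no_up q' r' (E1' \<inter> E2')"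
    unfolding no_up_def
  proof (intro allI impI)
    fix a b assume "(a, b) \<in> E1' \<inter> E2'"
    then show "\<not> (q' a < q' b \<and> r' a < r' b)"
      by (rule edge_cases) (use nu Q QT in \<open>auto simp: no_up_def\<close>)
  qed
  have nd': "no_down q' r' (E1' \<inter> E2')"
    unfolding no_down_def
  proof (intro allI impI)
    fix a b assume "(a, b) \<in> E1' \<inter> E2'"
    then show "\<not> (q' b < q' a \<and> r' b < r' a)"
      by (rule edge_cases) (use nd Q QT in \<open>auto simp: no_down_def\<close>)
  qed
  \<comment> \<open>Such a clique lies in the down-closure of the one selected vertex of its copy,
    whose second rank coordinate is less than \<open>j mod k\<close>. \<open>Z2\<close> is the
    counterpart for the other order and the first coordinate.\<close>
  have Z1: "card Z \<le> j mod k"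
    if asm: "s < M" "i < t s" "Z \<subseteq> V" "dclique Z (E1 \<inter> E2)" "\<And>x. x \<in> Z \<Longrightarrow> (i, x) \<in> U1 s" for s i Z
  proof (cases "Z = {}")
    case False
    then obtain x where x: "(i, x) \<in> S s" using asm(2,5) unfolding U1_def by fastforce
    then have "Z \<subseteq> down E1 q x" using asm(2,5) tS(3)[OF asm(1)] unfolding U1_def by fastforce
    moreover have "x \<in> V" using x tS(2)[OF asm(1)] by blast
    ultimately have "card Z \<le> Suc (\<rho> x mod k)" using cl1 asm(4) unfolding clique_le_def by blast
    then show ?thesis using tS(4)[OF asm(1) x asm(2)] by simp
  qed simp
  have Z2: "card Z \<le> j div k"
    if asm: "s < M" "t s \<le> i" "Z \<subseteq> V" "dclique Z (E1 \<inter> E2)" "\<And>x. x \<in> Z \<Longrightarrow> (i, x) \<in> U2 s" for s i Z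
  proof (cases "Z = {}")
    case False
    then obtain x where x: "(i, x) \<in> S s" using asm(2,5) unfolding U2_def by fastforce
    then have "Z \<subseteq> down E2 r x" using asm(2,5) tS(3)[OF asm(1)] unfolding U2_def by fastforce
    moreover have "x \<in> V" using x tS(2)[OF asm(1)] by blast
    ultimately have "card Z \<le> Suc (\<rho> x div k)" using cl2 asm(4) unfolding clique_le_def by blast
    then show ?thesis using tS(5)[OF asm(1) x asm(2)] by simp
  qed simp
  have clique_cases: thesis
    if "X \<subseteq> V'" "dclique X (E1' \<inter> E2')"
      and "\<And>i Z. X = Copy i ` Z \<Longrightarrow> card X = card Z \<Longrightarrow> Z \<subseteq> V \<Longrightarrow> dclique Z (E1 \<inter> E2) \<Longrightarrow> thesis"
      and "\<And>s i Z. X = insert (Top s Point) (Copy i ` Z) \<Longrightarrow> card X = Suc (card Z) \<Longrightarrow> s < M \<Longrightarrow>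
             Z \<subseteq> V \<Longrightarrow> dclique Z (E1 \<inter> E2) \<Longrightarrow> (\<And>x. x \<in> Z \<Longrightarrow> (i, x) \<in> U1 s \<inter> U2 s) \<Longrightarrow> thesis"
    for X thesis
    using that(1,2) unfolding V'_def E'
  proof (cases rule: dclique_ext_cases)
    case (base i Z)
    then show ?thesis using that(3)[of i Z] by (simp add: card_image inj_on_def)
  next
    case (top s Y i Z)
    have "Y = {Point}" using top by auto
    then have X: "X = insert (Top s Point) (Copy i ` Z)" using top(2) by simp
    have "finite (Copy i ` Z)" using fin top(6) finite_subset by blast
    then have "card X = Suc (card Z)" unfolding X
      by (subst card_insert_disjoint) (auto simp: card_image inj_on_def)
    then show ?thesis using that(4)[OF X] top unfolding U'_def by blast
  qed
  have cl': "clique_le V' (E1' \<inter> E2') k"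
    unfolding clique_le_def
  proof (intro allI impI)
    fix X assume "X \<subseteq> V'" "dclique X (E1' \<inter> E2')"
    then show "card X \<le> k"
    proof (rule clique_cases)
      fix i Z assume "card X = card Z" "Z \<subseteq> V" "dclique Z (E1 \<inter> E2)"
      then show ?thesis using cl unfolding clique_le_def by simp
    next
      fix s i Z assume Z: "card X = Suc (card Z)" "s < M" "Z \<subseteq> V" "dclique Z (E1 \<inter> E2)"
        "\<And>x. x \<in> Z \<Longrightarrow> (i, x) \<in> U1 s \<inter> U2 s"
      then have "card Z \<le> j mod k \<or> card Z \<le> j div k"
        using Z1[of s i Z] Z2[of s i Z] by (cases "i < t s") auto
      then show ?thesis using Z(1) k by linarith
    qed
  qed
  have down_Copy: "down E1' q' (Copy i x) \<subseteq> Copy i ` down E1 q x"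
    "down E2' r' (Copy i x) \<subseteq> Copy i ` down E2 r x" for i x
  proof -
    show "down E1' q' (Copy i x) \<subseteq> Copy i ` down E1 q x"
    proof
      fix v assume "v \<in> down E1' q' (Copy i x)"
      then show "v \<in> Copy i ` down E1 q x" by (cases v) (auto simp: down_def E1'_def Q)
    qed
    show "down E2' r' (Copy i x) \<subseteq> Copy i ` down E2 r x"
    proof
      fix v assume "v \<in> down E2' r' (Copy i x)"
      then show "v \<in> Copy i ` down E2 r x" by (cases v) (auto simp: down_def E2'_def Q)
    qed
  qed
  \<comment> \<open>Downwards in \<open>q'\<close> a new vertex sees only copies before its
    threshold, downwards in \<open>r'\<close> only the others. Hence its own two rank bounds follow
    from \<open>Z1\<close> and \<open>Z2\<close>, plus one for the vertex itself.\<close>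
  have down_Top1: "(i, z) \<in> U1 s \<and> i < t s" if "Copy i z \<in> down E1' q' (Top s Point)" for i z s
  proof -
    have *: "(i, z) \<in> U1 s" "q' (Copy i z) < q' (Top s Point)"
      using that unfolding down_def E1'_def by auto
    then show ?thesis using QT(1) unfolding U1_def by blast
  qed
  have down_Top2: "(i, z) \<in> U2 s \<and> t s \<le> i" if "Copy i z \<in> down E2' r' (Top s Point)" for i z s
  proof -
    have *: "(i, z) \<in> U2 s" "r' (Copy i z) < r' (Top s Point)"
      using that unfolding down_def E2'_def by auto
    then show ?thesis using QT(3) unfolding U2_def by blast
  qed
  have om': "oriented_magical V' p' q' E1'" "oriented_magical V' p' r' E2'"
    using b' unfolding bimagical_def V'_def E1'_def E2'_def by auto
  have cl1': "clique_le (down E1' q' v) (E1' \<inter> E2') (Suc (\<rho>' v mod k))" if "v \<in> V'" for v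
    unfolding clique_le_def
  proof (intro allI impI)
    fix X assume X: "X \<subseteq> down E1' q' v" and "dclique X (E1' \<inter> E2')"
    moreover from X have "X \<subseteq> V'" using down_subset[OF om'(1) that] by blast
    ultimately show "card X \<le> Suc (\<rho>' v mod k)"
    proof (elim clique_cases)
      fix i Z assume Z: "X = Copy i ` Z" "card X = card Z" "Z \<subseteq> V" "dclique Z (E1 \<inter> E2)"
      show ?thesis
      proof (cases v)
        case v: (Copy i' x)
        then have "Z \<subseteq> down E1 q x" using X Z(1) down_Copy(1)[of i' x] by blast
        moreover have "x \<in> V" using v that unfolding V'_def by simp
        ultimately show ?thesis using Z(2,4) cl1 v unfolding clique_le_def \<rho>'_def by simp
      next
        case v: (Top s x)
        then have *: "s < M" "x = Point" using that unfolding V'_def by auto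
        have "(i, z) \<in> U1 s \<and> i < t s" if "z \<in> Z" for z
          using that X Z(1) v * down_Top1 by blast
        then have "card Z \<le> j mod k"
          using Z1[OF *(1) _ Z(3,4), of i] by (cases "Z = {}") auto
        then show ?thesis using Z(2) v unfolding \<rho>'_def by simp
      qed (use that in \<open>simp add: V'_def\<close>)
    next
      fix s i Z assume Z: "X = insert (Top s Point) (Copy i ` Z)" "card X = Suc (card Z)" "Z \<subseteq> V"
        "dclique Z (E1 \<inter> E2)"
      show ?thesis
      proof (cases v)
        case (Copy i' x)
        then show ?thesis using X Z(1) down_Copy(1)[of i' x] by blast
      next
        case v: (Top s' x)
        then have *: "s' < M" "x = Point" using that unfolding V'_def by auto
        have "(i, z) \<in> U1 s' \<and> i < t s'" if "z \<in> Z" for z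
          using that X Z(1) v * down_Top1 by blast
        then have "card Z \<le> j mod k"
          using Z1[OF *(1) _ Z(3,4), of i] by (cases "Z = {}") auto
        then show ?thesis using Z(2) v unfolding \<rho>'_def by simp
      qed (use that in \<open>simp add: V'_def\<close>)
    qed
  qed
  have cl2': "clique_le (down E2' r' v) (E1' \<inter> E2') (Suc (\<rho>' v div k))" if "v \<in> V'" for v
    unfolding clique_le_def
  proof (intro allI impI)
    fix X assume X: "X \<subseteq> down E2' r' v" and "dclique X (E1' \<inter> E2')"
    moreover from X have "X \<subseteq> V'" using down_subset[OF om'(2) that] by blast
    ultimately show "card X \<le> Suc (\<rho>' v div k)"
    proof (elim clique_cases)
      fix i Z assume Z: "X = Copy i ` Z" "card X = card Z" "Z \<subseteq> V" "dclique Z (E1 \<inter> E2)"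
      show ?thesis
      proof (cases v)
        case v: (Copy i' x)
        then have "Z \<subseteq> down E2 r x" using X Z(1) down_Copy(2)[of i' x] by blast
        moreover have "x \<in> V" using v that unfolding V'_def by simp
        ultimately show ?thesis using Z(2,4) cl2 v unfolding clique_le_def \<rho>'_def by simp
      next
        case v: (Top s x)
        then have *: "s < M" "x = Point" using that unfolding V'_def by auto
        have "(i, z) \<in> U2 s \<and> t s \<le> i" if "z \<in> Z" for z
          using that X Z(1) v * down_Top2 by blast
        then have "card Z \<le> j div k"
          using Z2[OF *(1) _ Z(3,4), of i] by (cases "Z = {}") auto
        then show ?thesis using Z(2) v unfolding \<rho>'_def by simp
      qed (use that in \<open>simp add: V'_def\<close>)
    next
      fix s i Z assume Z: "X = insert (Top s Point) (Copy i ` Z)" "card X = Suc (card Z)" "Z \<subseteq> V"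
        "dclique Z (E1 \<inter> E2)"
      show ?thesis
      proof (cases v)
        case (Copy i' x)
        then show ?thesis using X Z(1) down_Copy(2)[of i' x] by blast
      next
        case v: (Top s' x)
        then have *: "s' < M" "x = Point" using that unfolding V'_def by auto
        have "(i, z) \<in> U2 s' \<and> t s' \<le> i" if "z \<in> Z" for z
          using that X Z(1) v * down_Top2 by blast
        then have "card Z \<le> j div k"
          using Z2[OF *(1) _ Z(3,4), of i] by (cases "Z = {}") auto
        then show ?thesis using Z(2) v unfolding \<rho>'_def by simp
      qed (use that in \<open>simp add: V'_def\<close>)
    qed
  qed
  have col': "colourable V' (E1' \<inter> E2') (Suc j)"
  proof -
    have "colourable {Point} {} 1" unfolding colourable_def proper_def by (intro exI[of _ "\<lambda>_. 0"]) auto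
    then have "colourable V' (E1' \<inter> E2') (j + 1)"
      unfolding V'_def E' using col
      by (intro colourable_ext) (use oriented_magicalD(1)[OF om(1)] UV in \<open>auto simp: U'_def\<close>)
    then show ?thesis by simp
  qed
  have "\<exists>\<phi>. (\<forall>i<Suc j. \<phi> i \<in> V' \<and> \<rho>' (\<phi> i) = i) \<and> inj_on (\<lambda>i. f (\<phi> i)) {..<Suc j}"
    if f: "f ` V' \<subseteq> {..<n}" "proper (E1' \<inter> E2') f" for f
  proof -
    have fn: "f v < n" if "v \<in> V'" for v using f(1) that by blast
    have "\<exists>\<phi>. (\<forall>l<j. \<phi> l \<in> V \<and> \<rho> (\<phi> l) = l) \<and> inj_on (\<lambda>l. f (Copy i (\<phi> l))) {..<j}" if "i < m" for i
    proof (rule fo)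
      show "(\<lambda>x. f (Copy i x)) ` V \<subseteq> {..<n}" using that by (auto intro!: fn simp: V'_def)
      show "proper (E1 \<inter> E2) (\<lambda>x. f (Copy i x))" using proper_Copy[OF _ that] f(2) unfolding E' by blast
    qed
    then obtain \<phi> where \<phi>: "\<And>i l. i < m \<Longrightarrow> l < j \<Longrightarrow> \<phi> i l \<in> V \<and> \<rho> (\<phi> i l) = l"
      "\<And>i. i < m \<Longrightarrow> inj_on (\<lambda>l. f (Copy i (\<phi> i l))) {..<j}" by metis
    define \<psi> where "\<psi> i = restrict (\<lambda>l. f (Copy i (\<phi> i l))) {..<j}" for i
    define P where "P = ({..<j} \<rightarrow>\<^sub>E {..<n})"
    have "\<psi> i \<in> P" if "i < m" for i
      unfolding \<psi>_def P_def restrict_PiE_iff using \<phi>(1) that by (auto intro!: fn simp: V'_def)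
    then have "\<psi> ` {..<m} \<subseteq> P" by blast
    moreover have "finite P" "card P = n ^ j" unfolding P_def by (simp_all add: finite_PiE card_PiE)
    moreover from this have "card P * (2 * j) < card {..<m}" unfolding m_def by simp
    ultimately obtain c where c: "2 * j < card {i \<in> {..<m}. \<psi> i = c}"
      using large_fibre[of "{..<m}" P \<psi> "2 * j"] by auto
    define J where "J = {i \<in> {..<m}. \<psi> i = c}"
    have "finite J" unfolding J_def by simp
    then obtain e where e: "\<And>l. l < card J \<Longrightarrow> e l \<in> J" "\<And>l l'. l < l' \<Longrightarrow> l' < card J \<Longrightarrow> e l < e l'"
      using increasing_selection by blast
    have cJ: "2 * j < card J" using c unfolding J_def .
    \<comment> \<open>With the threshold at copy \<open>e j\<close>, ranks with smaller second
      coordinate are looked up in \<open>e 0, ..., e (j - 1)\<close>, the others in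
      \<open>e j, ..., e (2 * j - 1)\<close>. So different ranks use different copies, and
      \<open>2 * j < card J\<close> provides enough of them.\<close>
    define \<iota> where "\<iota> l = e (if l mod k < j mod k then l else j + l)" for l
    have \<iota>J: "\<iota> l \<in> J" if "l < j" for l using e(1) that cJ unfolding \<iota>_def by auto
    have J: "i < m" "\<psi> i = c" if "i \<in> J" for i using that unfolding J_def by auto
    have e_inj: "l = l'" if "e l = e l'" "l < card J" "l' < card J" for l l'
      using e(2)[of l l'] e(2)[of l' l] that by (cases l l' rule: linorder_cases) auto
    have \<iota>_inj: "l = l'" if "\<iota> l = \<iota> l'" "l < j" "l' < j" for l l'
    proof -
      have "(if l mod k < j mod k then l else j + l) < card J"
        "(if l' mod k < j mod k then l' else j + l') < card J"
        using that(2,3) cJ by simp_all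
      then have "(if l mod k < j mod k then l else j + l) = (if l' mod k < j mod k then l' else j + l')"
        using e_inj that(1) unfolding \<iota>_def by blast
      then show ?thesis using that(2,3) by (simp split: if_splits)
    qed
    have \<iota>_less: "\<iota> l < e j \<longleftrightarrow> l mod k < j mod k" if "l < j" for l
    proof (cases "l mod k < j mod k")
      case True
      then show ?thesis using e(2)[of l j] that cJ unfolding \<iota>_def by simp
    next
      case False
      have "e j \<le> e (j + l)" using e(2)[of j "j + l"] that cJ by (cases "l = 0") auto
      then show ?thesis using False unfolding \<iota>_def by simp
    qed
    \<comment> \<open>An earlier rank in lexicographic order whose second coordinate is not smaller
      must have a smaller first one, so it may be selected beyond the threshold.\<close>
    have lex: "l div k < j div k" if "l < j" "\<not> l mod k < j mod k" for l
    proof -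
      have "l div k \<le> j div k" using that(1) by (simp add: div_le_mono)
      moreover have "l div k \<noteq> j div k"
        using that div_mult_mod_eq[of l k] div_mult_mod_eq[of j k] by (metis add_less_cancel_left)
      ultimately show ?thesis by simp
    qed
    have ej: "e j \<in> J" using e(1) cJ by simp
    have "(e j, (\<lambda>l. (\<iota> l, \<phi> (\<iota> l) l)) ` {..<j}) \<in> Ch"
      unfolding Ch_def
    proof (clarify, intro conjI allI impI)
      show "e j \<le> m" using J(1)[OF ej] by simp
      show "(\<lambda>l. (\<iota> l, \<phi> (\<iota> l) l)) ` {..<j} \<subseteq> {..<m} \<times> V"
        using J(1) \<iota>J \<phi>(1) by blast
    next
      fix i x y assume "(i, x) \<in> (\<lambda>l. (\<iota> l, \<phi> (\<iota> l) l)) ` {..<j}" "(i, y) \<in> (\<lambda>l. (\<iota> l, \<phi> (\<iota> l) l)) ` {..<j}"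
      then show "x = y" using \<iota>_inj by blast
    next
      fix i x assume "(i, x) \<in> (\<lambda>l. (\<iota> l, \<phi> (\<iota> l) l)) ` {..<j}"
      then obtain l where l: "l < j" "i = \<iota> l" "x = \<phi> (\<iota> l) l" by blast
      then have "\<rho> x = l" using \<phi>(1) J(1) \<iota>J by blast
      then show "i < e j \<Longrightarrow> \<rho> x mod k < j mod k" "e j \<le> i \<Longrightarrow> \<rho> x div k < j div k"
        using \<iota>_less[OF l(1)] lex[OF l(1)] l(2) by simp_all
    qed
    then have "(e j, (\<lambda>l. (\<iota> l, \<phi> (\<iota> l) l)) ` {..<j}) \<in> ch ` {..<M}" unfolding ch .
    then obtain s where s: "s < M" "ch s = (e j, (\<lambda>l. (\<iota> l, \<phi> (\<iota> l) l)) ` {..<j})"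
      by (elim imageE) simp
    have ts: "t s = e j" "S s = (\<lambda>l. (\<iota> l, \<phi> (\<iota> l) l)) ` {..<j}"
      using s(2) unfolding t_def S_def by simp_all
    have same: "f (Copy i (\<phi> i l)) = c l" if "i \<in> J" "l < j" for i l
      using J(2)[OF that(1)] that(2) unfolding \<psi>_def by (metis lessThan_iff restrict_apply')
    \<comment> \<open>All copies in \<open>J\<close> have the same pattern, so seeing rank
      \<open>l\<close> in copy \<open>\<iota> l\<close> excludes the colour \<open>c l\<close> that
      this rank also has in copy \<open>e j\<close>.\<close>
    have new: "f (Top s Point) \<noteq> c l" if "l < j" for l
    proof -
      have i: "\<iota> l < m" "\<phi> (\<iota> l) l \<in> V" using J(1) \<iota>J \<phi>(1) that by blast+
      moreover have "(\<iota> l, \<phi> (\<iota> l) l) \<in> S s" using ts(2) that by blast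
      ultimately have "(\<iota> l, \<phi> (\<iota> l) l) \<in> U' s"
        unfolding U'_def U1_def U2_def down_def by auto
      then have "(Top s Point, Copy (\<iota> l) (\<phi> (\<iota> l) l)) \<in> E1' \<inter> E2'"
        unfolding E' using s(1) by simp
      then have "f (Top s Point) \<noteq> f (Copy (\<iota> l) (\<phi> (\<iota> l) l))" using f(2) unfolding proper_def by blast
      then show ?thesis using same[OF \<iota>J[OF that] that] by simp
    qed
    \<comment> \<open>All old ranks are read off in the single copy \<open>e j\<close>; the new
      vertex realises rank \<open>j\<close> with a colour different from theirs.\<close>
    define \<phi>' where "\<phi>' l = (if l < j then Copy (e j) (\<phi> (e j) l) else Top s Point)" for l
    have "\<forall>i<Suc j. \<phi>' i \<in> V' \<and> \<rho>' (\<phi>' i) = i"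
      using \<phi>(1)[OF J(1)[OF ej]] J(1)[OF ej] s(1) unfolding \<phi>'_def V'_def \<rho>'_def by (auto simp: less_Suc_eq)
    moreover have "inj_on (\<lambda>i. f (\<phi>' i)) {..<Suc j}"
    proof (rule inj_onI)
      fix a b assume ab: "a \<in> {..<Suc j}" "b \<in> {..<Suc j}" "f (\<phi>' a) = f (\<phi>' b)"
      have c_inj: "l = l'" if "l < j" "l' < j" "c l = c l'" for l l'
        using \<phi>(2)[OF J(1)[OF ej]] same[OF ej] that unfolding inj_on_def by (metis lessThan_iff)
      have "f (\<phi>' l) = (if l < j then c l else f (Top s Point))" for l
        using same[OF ej] unfolding \<phi>'_def by simp
      then show "a = b" using ab c_inj[of a b] new[of a] new[of b] by (auto split: if_splits)
    qed
    ultimately show ?thesis by blast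
  qed
  then have "ranked n k (Suc j) V' p' q' r' E1' E2' \<rho>'"
    unfolding ranked_def using b' nu' nd' cl' col' cl1' cl2'
    unfolding V'_def E1'_def E2'_def by blast
  then show ?thesis using that by blast
qed

section \<open>Assembling the extremal graphs\<close>

lemma ex_ranked:
  assumes "j \<le> k * k"
  shows "\<exists>(V :: vertex set) p q r E1 E2 \<rho>. ranked n k j V p q r E1 E2 \<rho>"
  using assms
proof (induction j)
  case 0
  show ?case using ranked_empty by blast
next
  case (Suc j)
  then obtain V :: "vertex set" and p q r E1 E2 \<rho> where R: "ranked n k j V p q r E1 E2 \<rho>" by auto
  have "j < k * k" using Suc.prems by simp
  from R this obtain V' p' q' r' and E1' E2' :: "vertex rel" and \<rho>' where
    "ranked n k (Suc j) V' p' q' r' E1' E2' \<rho>'"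
    by (rule ranked_step)
  then show ?case by blast
qed

text \<open>For \<open>j = k * k\<close> every rank with both coordinates below \<open>k\<close> is
  realised, by vertices of pairwise different colours.\<close>

lemma ex_square_extremal:
  "\<exists>(V :: vertex set) p q r E1 E2. extremal n k (k * k) V p q r E1 E2 \<and>
     no_up q r (E1 \<inter> E2) \<and> no_down q r (E1 \<inter> E2)"
proof -
  obtain V :: "vertex set" and p q r E1 E2 \<rho> where R: "ranked n k (k * k) V p q r E1 E2 \<rho>"
    using ex_ranked by blast
  then have fin: "finite V" unfolding ranked_def bimagical_def by blast
  have "forces n V (E1 \<inter> E2) (k * k)"
    unfolding forces_def
  proof (intro allI impI)
    fix f :: "vertex \<Rightarrow> nat" assume "f ` V \<subseteq> {..<n}" "proper (E1 \<inter> E2) f"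
    then obtain \<phi> where \<phi>: "\<forall>i<k * k. \<phi> i \<in> V" "inj_on (\<lambda>i. f (\<phi> i)) {..<k * k}"
      using R unfolding ranked_def by blast
    have "k * k = card ((\<lambda>i. f (\<phi> i)) ` {..<k * k})" using \<phi>(2) by (simp add: card_image)
    also have "\<dots> \<le> card (f ` V)" using \<phi>(1) fin by (intro card_mono) auto
    finally show "k * k \<le> card (f ` V)" .
  qed
  then have "extremal n k (k * k) V p q r E1 E2"
    using R unfolding extremal_def ranked_def by blast
  moreover have "no_up q r (E1 \<inter> E2)" "no_down q r (E1 \<inter> E2)"
    using R unfolding ranked_def by blast+
  ultimately show ?thesis by blast
qed

lemma extremal_empty: "extremal n k 0 ({} :: 'a set) (\<lambda>_. 0) (\<lambda>_. 0) (\<lambda>_. 0) {} {}"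
  unfolding extremal_def bimagical_def oriented_magical_def clique_le_def forces_def
    colourable_def proper_def by auto

text \<open>Each induction step joins the graph for \<open>k\<close> to the square graph for
  \<open>Suc k\<close>. The latter has no doubly descending edges, as the join requires, and no
  doubly ascending ones, so this second property is passed on.\<close>

lemma ex_pyramidal_extremal:
  "\<exists>(V :: vertex set) p q r E1 E2. extremal n k (\<Sum>i\<le>k. i * i) V p q r E1 E2 \<and>
     no_up q r (E1 \<inter> E2)"
proof (induction k)
  case 0
  have "no_up (\<lambda>_. 0) (\<lambda>_. 0) ({} \<inter> {})" by (simp add: no_up_def)
  then show ?case using extremal_empty[of n 0] by (auto intro!: exI)
next
  case (Suc k)
  then obtain W :: "vertex set" and pW qW rW F1 F2 where
    K: "extremal n k (\<Sum>i\<le>k. i * i) W pW qW rW F1 F2" "no_up qW rW (F1 \<inter> F2)" by blast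
  obtain V :: "vertex set" and p q r E1 E2 where
    H: "extremal n (Suc k) (Suc k * Suc k) V p q r E1 E2" "no_up q r (E1 \<inter> E2)" "no_down q r (E1 \<inter> E2)"
    using ex_square_extremal by blast
  have pos: "0 < Suc k * Suc k" by simp
  obtain V' p' q' r' and E1' E2' :: "vertex rel" where
    J: "extremal n (Suc k) (Suc k * Suc k + (\<Sum>i\<le>k. i * i)) V' p' q' r' E1' E2'"
    "no_up q r (E1 \<inter> E2) \<longrightarrow> no_up qW rW (F1 \<inter> F2) \<longrightarrow> no_up q' r' (E1' \<inter> E2')"
    "\<forall>X\<subseteq>W. dclique X (F1 \<inter> F2) \<longrightarrow>
       (\<exists>X'\<subseteq>V'. dclique X' (E1' \<inter> E2') \<and> card X' = Suc (card X))"
    by (rule extremal_join[OF H(1,3) K(1) pos])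
  have "Suc k * Suc k + (\<Sum>i\<le>k. i * i) = (\<Sum>i\<le>Suc k. i * i)" by simp
  then have "extremal n (Suc k) (\<Sum>i\<le>Suc k. i * i) V' p' q' r' E1' E2'" using J(1) by (simp only:)
  then show ?case using J(2) H(2) K(2) by blast
qed

text \<open>Mirroring turns the absence of doubly ascending edges in a pyramidal graph into the
  absence of doubly descending ones, so \<open>extremal_join\<close> applies again. Every join
  lengthens a given clique by one, which shows that the bound \<open>k\<close> is attained.\<close>

lemma ex_extremal:
  "\<exists>(V :: vertex set) p q r E1 E2. extremal n k (\<Sum>j\<le>k. \<Sum>i\<le>j. i * i) V p q r E1 E2 \<and>
     (\<exists>X\<subseteq>V. dclique X (E1 \<inter> E2) \<and> card X = k)"
proof (induction k)
  case 0
  have "\<exists>X\<subseteq>{}. dclique X ({} \<inter> {}) \<and> card X = 0" by (simp add: dclique_def)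
  then show ?case using extremal_empty[of n 0] by (auto intro!: exI)
next
  case (Suc k)
  then obtain W :: "vertex set" and pW qW rW F1 F2 X where
    K: "extremal n k (\<Sum>j\<le>k. \<Sum>i\<le>j. i * i) W pW qW rW F1 F2"
    and X: "X \<subseteq> W" "dclique X (F1 \<inter> F2)" "card X = k" by blast
  obtain V :: "vertex set" and p q r E1 E2 where
    H: "extremal n (Suc k) (\<Sum>i\<le>Suc k. i * i) V p q r E1 E2" "no_up q r (E1 \<inter> E2)"
    using ex_pyramidal_extremal by blast
  have nd: "no_down q r (E1\<inverse> \<inter> E2\<inverse>)" using no_down_mirror[OF H(2)] by (simp add: converse_Int)
  have pos: "0 < (\<Sum>i\<le>Suc k. i * i)" by simp
  obtain V' p' q' r' and E1' E2' :: "vertex rel" where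
    J: "extremal n (Suc k) ((\<Sum>i\<le>Suc k. i * i) + (\<Sum>j\<le>k. \<Sum>i\<le>j. i * i)) V' p' q' r' E1' E2'"
    "no_up q r (E1\<inverse> \<inter> E2\<inverse>) \<longrightarrow> no_up qW rW (F1 \<inter> F2) \<longrightarrow> no_up q' r' (E1' \<inter> E2')"
    "\<forall>X\<subseteq>W. dclique X (F1 \<inter> F2) \<longrightarrow>
       (\<exists>X'\<subseteq>V'. dclique X' (E1' \<inter> E2') \<and> card X' = Suc (card X))"
    by (rule extremal_join[OF extremal_mirror[OF H(1)] nd K pos])
  have "(\<Sum>i\<le>Suc k. i * i) + (\<Sum>j\<le>k. \<Sum>i\<le>j. i * i) = (\<Sum>j\<le>Suc k. \<Sum>i\<le>j. i * i)" by simp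
  then have "extremal n (Suc k) (\<Sum>j\<le>Suc k. \<Sum>i\<le>j. i * i) V' p' q' r' E1' E2'"
    using J(1) by (simp only:)
  moreover have "\<exists>X'\<subseteq>V'. dclique X' (E1' \<inter> E2') \<and> card X' = Suc k"
    using J(3)[rule_format, OF X(1,2)] X(3) by simp
  ultimately show ?case by blast
qed

section \<open>From oriented to double-magical graphs\<close>

definition undirected :: "('a \<Rightarrow> nat) \<Rightarrow> 'a rel \<Rightarrow> nat set set" where
  "undirected e R = {{e x, e y} | x y. (x, y) \<in> R}"

text \<open>Equal positions are separated by the codes under \<open>e\<close>, which makes the order
  total.\<close>

definition position_order :: "('a \<Rightarrow> nat) \<Rightarrow> 'a set \<Rightarrow> ('a \<Rightarrow> int) \<Rightarrow> nat rel" where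
  "position_order e V q = {(e x, e y) | x y. x \<in> V \<and> y \<in> V \<and> (q x < q y \<or> q x = q y \<and> e x < e y)}"

context
  fixes e :: "'a \<Rightarrow> nat"
  assumes e: "inj e"
begin

lemma undirected_iff [simp]: "{e x, e y} \<in> undirected e R \<longleftrightarrow> (x, y) \<in> R \<or> (y, x) \<in> R"
  using e unfolding undirected_def by (auto simp: doubleton_eq_iff inj_eq)

lemma position_order_iff [simp]:
  "(e x, e y) \<in> position_order e V q \<longleftrightarrow>
     x \<in> V \<and> y \<in> V \<and> (q x < q y \<or> q x = q y \<and> e x < e y)"
  using e unfolding position_order_def by (auto simp: inj_eq)

lemma total_order_position: "total_order (e ` V) (position_order e V q)"
proof -
  have "trans (position_order e V q)"
    unfolding trans_def position_order_def using e by (auto simp: inj_eq)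
  moreover have "irrefl (position_order e V q)"
    unfolding irrefl_def position_order_def using e by (auto simp: inj_eq)
  moreover have "total_on (e ` V) (position_order e V q)"
    unfolding total_on_def by (auto simp: neq_iff)
  ultimately show ?thesis
    unfolding total_order_def strict_linear_order_on_def by (auto simp: position_order_def)
qed

lemma is_graph_undirected:
  assumes "oriented_magical V p q E" "R \<subseteq> E"
  shows "is_graph (e ` V) (undirected e R)"
  unfolding is_graph_def
proof
  fix d assume "d \<in> undirected e R"
  then obtain x y where d: "d = {e x, e y}" "(x, y) \<in> E" using assms(2) unfolding undirected_def by blast
  then have "x \<in> V" "y \<in> V" "x \<noteq> y" using oriented_magicalD(1,2)[OF assms(1)] by auto
  then show "d \<in> nsets (e ` V) 2" using d(1) by (simp add: nsets_def inj_eq[OF e])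
qed

text \<open>Edges increase \<open>p\<close>, so an edge whose ends come in the order
  \<open>a\<close>, \<open>b\<close> can only be the oriented edge \<open>(a, b)\<close>. If the
  short-cut is missing, \<open>b\<close> is not above either neighbour in \<open>q\<close>, and
  adjacent vertices never tie.\<close>

lemma magical_undirected:
  assumes om: "oriented_magical V p q E"
  shows "magical (e ` V) (undirected e E) (position_order e V p) (position_order e V q)"
proof -
  note E = oriented_magicalD[OF om]
  have "(e b, e a) \<in> position_order e V q \<and> (e b, e c) \<in> position_order e V q"
    if abc: "a \<in> V" "b \<in> V" "c \<in> V" "(e a, e b) \<in> position_order e V p" "(e b, e c) \<in> position_order e V p"
      "{e a, e b} \<in> undirected e E" "{e b, e c} \<in> undirected e E" "{e a, e c} \<notin> undirected e E" for a b c
  proof -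
    have "(a, b) \<in> E" "(b, c) \<in> E" using abc(4-7) E(2)[of b a] E(2)[of c b] by auto
    moreover from this have "q b < q a \<and> q b < q c"
      using E(2)[of a b] E(2)[of b c] E(3)[of a b c] abc(8) by (auto simp: neq_iff)
    ultimately show ?thesis using abc(1-3) by simp
  qed
  then show ?thesis
    unfolding magical_def using is_graph_undirected[OF om] total_order_position by blast
qed

lemma double_magical_undirected:
  assumes b: "bimagical V p q r E1 E2"
  shows "double_magical (e ` V) (undirected e (E1 \<inter> E2))"
proof -
  have om: "oriented_magical V p q E1" "oriented_magical V p r E2"
    using b unfolding bimagical_def by auto
  \<comment> \<open>Both orientations follow the same \<open>p\<close>, so an edge common to the two
    graphs cannot be oriented in opposite ways.\<close>
  have "undirected e (E1 \<inter> E2) = undirected e E1 \<inter> undirected e E2"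
  proof (intro equalityI subsetI)
    fix d assume d: "d \<in> undirected e E1 \<inter> undirected e E2"
    then obtain x y where xy: "d = {e x, e y}" "(x, y) \<in> E1" unfolding undirected_def by blast
    then have "(x, y) \<in> E2 \<or> (y, x) \<in> E2" using d by simp
    then have "(x, y) \<in> E2"
      using oriented_magicalD(2)[OF om(1) xy(2)] oriented_magicalD(2)[OF om(2), of y x] by auto
    then show "d \<in> undirected e (E1 \<inter> E2)" using xy by simp
  qed (auto simp: undirected_def)
  then show ?thesis
    unfolding double_magical_def double_magical_wrt_def
    using magical_undirected[OF om(1)] magical_undirected[OF om(2)] total_order_position
      is_graph_undirected[OF om(1), of "E1 \<inter> E2"] by blast
qed

lemma clique_undirected: "clique (e ` X) (undirected e R) \<longleftrightarrow> dclique X R"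
  unfolding clique_def dclique_def using e by (simp add: inj_eq)

lemma clique_number_undirected:
  assumes "clique_le V R k" "X \<subseteq> V" "dclique X R" "card X = k"
  shows "clique_number (e ` V) (undirected e R) = k"
  unfolding clique_number_def
proof (rule Max_eqI)
  have "card K \<le> k" if K: "K \<subseteq> e ` V" "clique K (undirected e R)" for K
  proof -
    obtain Z where Z: "Z \<subseteq> V" "K = e ` Z" using K(1) by (meson subset_imageE)
    then have "card Z \<le> k" using K(2) assms(1) clique_undirected unfolding clique_le_def by blast
    moreover have "card K = card Z" unfolding Z(2) using e by (simp add: card_image inj_on_subset)
    ultimately show ?thesis by simp
  qed
  then show "y \<le> k" if "y \<in> {card K |K. K \<subseteq> e ` V \<and> clique K (undirected e R)}" for y
    using that by blast
  then show "finite {card K |K. K \<subseteq> e ` V \<and> clique K (undirected e R)}"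
    by (meson finite_nat_set_iff_bounded_le)
  have "card (e ` X) = k" using assms(4) e by (simp add: card_image inj_on_subset)
  moreover have "e ` X \<subseteq> e ` V" "clique (e ` X) (undirected e R)"
    using assms(2,3) clique_undirected by blast+
  ultimately show "k \<in> {card K |K. K \<subseteq> e ` V \<and> clique K (undirected e R)}" by blast
qed

lemma chromatic_number_undirected:
  assumes V: "finite V" and R: "R \<subseteq> V \<times> V" and fo: "forces N V R N" and col: "colourable V R N"
  shows "chromatic_number (e ` V) (undirected e R) = N"
  unfolding chromatic_number_def
proof (rule Least_equality)
  obtain g where g: "g ` V \<subseteq> {..<N}" "proper R g" using col unfolding colourable_def by blast
  have "proper_colouring (e ` V) (undirected e R) N (g \<circ> inv e)"
    using g e unfolding proper_colouring_def proper_def by (fastforce simp: image_image)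
  then show "\<exists>f. proper_colouring (e ` V) (undirected e R) N f" by blast
next
  fix m assume "\<exists>f. proper_colouring (e ` V) (undirected e R) m f"
  then obtain f where f: "(f \<circ> e) ` V \<subseteq> {..<m}"
    "\<And>x y. x \<in> V \<Longrightarrow> y \<in> V \<Longrightarrow> {e x, e y} \<in> undirected e R \<Longrightarrow> f (e x) \<noteq> f (e y)"
    unfolding proper_colouring_def by (auto simp: image_comp)
  have "proper R (f \<circ> e)" unfolding proper_def using f(2) R by auto
  moreover have "card ((f \<circ> e) ` V) \<le> m" using card_mono[OF _ f(1)] by simp
  \<comment> \<open>A colouring with fewer than \<open>N\<close> colours is also a colouring from
    the palette of size \<open>N\<close>, so \<open>forces N\<close> applies to it.\<close>
  moreover have "(f \<circ> e) ` V \<subseteq> {..<N}" if "m < N" using f(1) that by fastforce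
  ultimately show "N \<le> m" using fo unfolding forces_def by (metis le_trans linorder_not_le)
qed

end

section \<open>The number of colours in closed form, and the conclusion\<close>

lemma sum_of_sums_of_squares: "12 * (\<Sum>j\<le>k. \<Sum>i\<le>j. i * i) = k * (k + 1) * (k + 1) * (k + 2)" for k :: nat
proof (induction k)
  case (Suc k)
  have "6 * (\<Sum>i\<le>m. i * i) = m * (m + 1) * (2 * m + 1)" for m :: nat
    by (induction m) (simp_all add: algebra_simps)
  from this[of "Suc k"] show ?case using Suc by (simp add: algebra_simps)
qed simp

theorem theorem9:
  fixes k :: nat
  assumes "k \<ge> 2"
  shows "\<exists>(V :: nat set) E. finite V \<and> is_graph V E \<and> double_magical V E \<and>
           clique_number V E = k \<and>
           real (chromatic_number V E) = (real k + 1) / 2 * real ((k + 2) choose 3)"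
proof -
  define N :: nat where "N = (\<Sum>j\<le>k. \<Sum>i\<le>j. i * i)"
  \<comment> \<open>The palette size is set to \<open>N\<close> itself, as needed for
    \<open>chromatic_number_undirected\<close>.\<close>
  obtain V :: "vertex set" and p q r E1 E2 X where ext: "extremal N k N V p q r E1 E2"
    and X: "X \<subseteq> V" "dclique X (E1 \<inter> E2)" "card X = k"
    using ex_extremal[of N k] unfolding N_def by blast
  have b: "bimagical V p q r E1 E2" and cl: "clique_le V (E1 \<inter> E2) k"
    and fo: "forces N V (E1 \<inter> E2) N" and col: "colourable V (E1 \<inter> E2) N"
    using ext unfolding extremal_def by blast+
  have fin: "finite V" and om: "oriented_magical V p q E1" using b unfolding bimagical_def by auto
  let ?e = "to_nat :: vertex \<Rightarrow> nat"
  have e: "inj ?e" by simp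
  have R: "E1 \<inter> E2 \<subseteq> V \<times> V" using oriented_magicalD(1)[OF om] by blast
  have choose: "6 * ((k + 2) choose 3) = (k + 2) * (k + 1) * k"
    using Suc_times_binomial_eq[of "k + 1" 2] Suc_times_binomial_eq[of k 1]
    by (simp add: eval_nat_numeral algebra_simps)
  have "12 * real N = real k * (real k + 1) * (real k + 1) * (real k + 2)"
    using arg_cong[OF sum_of_sums_of_squares[of k], of real] unfolding N_def[symmetric] by (simp add: algebra_simps)
  moreover have "6 * real ((k + 2) choose 3) = (real k + 2) * (real k + 1) * real k"
    using arg_cong[OF choose, of real] by (simp only: of_nat_mult of_nat_add of_nat_numeral of_nat_1)
  ultimately have "12 * real N = (real k + 1) * (6 * real ((k + 2) choose 3))"
    by (simp only: mult_ac)
  then have "real N = (real k + 1) / 2 * real ((k + 2) choose 3)" by simp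
  then show ?thesis
    using is_graph_undirected[OF e om, of "E1 \<inter> E2"] double_magical_undirected[OF e b]
      clique_number_undirected[OF e cl X] chromatic_number_undirected[OF e fin R fo col] fin
    by (intro exI[of _ "?e ` V"] exI[of _ "undirected ?e (E1 \<inter> E2)"]) auto
qed

end
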